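(* Let $\mathbb{L}$ be an $L$-shaped floor-plan, and let $W_1$ and $W_2$ be the two boundary walls of $\mathbb{L}$ that meet at its unique concave corner. Then $\mathbb{L}$ is non-trivial if and only if there exist three exterior modules $A$, $B$, $C$, each sharing a boundary wall segment with $W_1$ or $W_2$, such that either ($A$ and $B$ are vertically adjacent and $B$ and $C$ are horizontally adjacent) or ($A$ and $B$ are horizontally adjacent and $B$ and $C$ are vertically adjacent).
   Context: A floor-plan is a partition of a polygon (its boundary) by axis-parallel straight line segments into component polygons called modules; the sides of modules are walls. Two modules are adjacent if they share a wall or a section of a wall of positive length (touching at a point is not enough). Two modules are vertically adjacent if they share a horizontal wall segment and horizontally adjacent if they share a vertical wall segment. An exterior module is one sharing a wall segment with the boundary. A concave corner of a rectilinear boundary is a boundary corner with outer angle $90^\circ$ (i.e. interior angle $270^\circ$). An $L$-shaped floor-plan $\mathbb{L}$ is a floor-plan all of whose modules are rectangles and whose boundary is a rectilinear polygon with exactly one concave corner (so its boundary consists of six walls, five convex corners and one concave corner). A floor-plan with $k$ concave corners is trivial if, by stretching or shrinking its outer walls while preserving all adjacencies between modules (creating or destroying none), it can be transformed into a floor-plan with fewer than $k$ concave corners; otherwise it is non-trivial. In particular, an $L$-shaped floor-plan is non-trivial if it cannot be so transformed into a rectangular floor-plan.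
   Formalization: Adds the assumption that W1 and W2 are not both continued straight into the interior by module walls at the concave corner; otherwise (e.g. three unit squares forming an L) the plan is non-trivial but no such triple A, B, C exists. *)

theory Defs
  imports "HOL-Analysis.Analysis"
begin

datatype edge = West | East | South | North

text \<open>A rectangular module is given by the coordinates of the lines carrying its four sides.\<close>

type_synonym rect = "edge \<Rightarrow> real"

definition rect_set :: "rect \<Rightarrow> (real \<times> real) set" where
  "rect_set r = {r West..r East} \<times> {r South..r North}"

fun side :: "rect \<Rightarrow> edge \<Rightarrow> (real \<times> real) set" where
  "side r West = {r West} \<times> {r South..r North}"
| "side r East = {r East} \<times> {r South..r North}"
| "side r South = {r West..r East} \<times> {r South}"
| "side r North = {r West..r East} \<times> {r North}"

definition share_segment :: "(real \<times> real) set \<Rightarrow> (real \<times> real) set \<Rightarrow> bool" where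
  "share_segment S T \<longleftrightarrow> (\<exists>a b. a \<noteq> b \<and> closed_segment a b \<subseteq> S \<inter> T)"

definition region :: "'m set \<Rightarrow> ('m \<Rightarrow> rect) \<Rightarrow> (real \<times> real) set" where
  "region M R = (\<Union>i\<in>M. rect_set (R i))"

text \<open>Floor-plans with rectangular modules. The frontier of a finite union of axis-parallel
  rectangles consists of finitely many axis-parallel segments, so requiring it to be a simple
  closed curve says that the modules partition a (simple) rectilinear polygon.\<close>

definition floor_plan :: "'m set \<Rightarrow> ('m \<Rightarrow> rect) \<Rightarrow> bool" where
  "floor_plan M R \<longleftrightarrow>
     finite M \<and>
     (\<forall>i\<in>M. R i West < R i East \<and> R i South < R i North) \<and>
     (\<forall>i\<in>M. \<forall>j\<in>M. i \<noteq> j \<longrightarrow> interior (rect_set (R i)) \<inter> interior (rect_set (R j)) = {}) \<and>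
     (\<exists>g. simple_path g \<and> pathfinish g = pathstart g \<and> path_image g = frontier (region M R))"

definition vertically_adjacent :: "('m \<Rightarrow> rect) \<Rightarrow> 'm \<Rightarrow> 'm \<Rightarrow> bool" where
  "vertically_adjacent R i j \<longleftrightarrow> i \<noteq> j \<and>
     (\<exists>e\<in>{South, North}. \<exists>e'\<in>{South, North}. share_segment (side (R i) e) (side (R j) e'))"

definition horizontally_adjacent :: "('m \<Rightarrow> rect) \<Rightarrow> 'm \<Rightarrow> 'm \<Rightarrow> bool" where
  "horizontally_adjacent R i j \<longleftrightarrow> i \<noteq> j \<and>
     (\<exists>e\<in>{West, East}. \<exists>e'\<in>{West, East}. share_segment (side (R i) e) (side (R j) e'))"

definition adjacent :: "('m \<Rightarrow> rect) \<Rightarrow> 'm \<Rightarrow> 'm \<Rightarrow> bool" where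
  "adjacent R i j \<longleftrightarrow> vertically_adjacent R i j \<or> horizontally_adjacent R i j"

text \<open>A wall of the boundary polygon is a maximal straight piece of the frontier.\<close>

definition boundary_wall :: "(real \<times> real) set \<Rightarrow> (real \<times> real) set \<Rightarrow> bool" where
  "boundary_wall P w \<longleftrightarrow>
     (\<exists>a b. a \<noteq> b \<and> (fst a = fst b \<or> snd a = snd b) \<and> w = closed_segment a b) \<and>
     w \<subseteq> frontier P \<and>
     (\<forall>a b. w \<subseteq> closed_segment a b \<and> closed_segment a b \<subseteq> frontier P \<longrightarrow> closed_segment a b = w)"

definition has_side_on :: "('m \<Rightarrow> rect) \<Rightarrow> 'm \<Rightarrow> (real \<times> real) set \<Rightarrow> bool" where
  "has_side_on R i S \<longleftrightarrow> (\<exists>e. share_segment (side (R i) e) S)"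

definition exterior_module :: "'m set \<Rightarrow> ('m \<Rightarrow> rect) \<Rightarrow> 'm \<Rightarrow> bool" where
  "exterior_module M R i \<longleftrightarrow> i \<in> M \<and> has_side_on R i (frontier (region M R))"

text \<open>Interior angle 270 degrees: near the point, the polygon is the complement of one open
  quadrant, whose position is given by the signs \<open>sx\<close> and \<open>sy\<close>.\<close>

definition concave_corner :: "(real \<times> real) set \<Rightarrow> real \<times> real \<Rightarrow> bool" where
  "concave_corner P p \<longleftrightarrow>
     (\<exists>sx\<in>{-1, 1}. \<exists>sy\<in>{-1, 1}. \<exists>\<epsilon>>0. \<forall>u v. \<bar>u\<bar> < \<epsilon> \<and> \<bar>v\<bar> < \<epsilon> \<longrightarrow>
        (p + (u, v) \<in> P \<longleftrightarrow> \<not> (sx * u > 0 \<and> sy * v > 0)))"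

definition num_concave_corners :: "'m set \<Rightarrow> ('m \<Rightarrow> rect) \<Rightarrow> nat" where
  "num_concave_corners M R = card {p. concave_corner (region M R) p}"

definition L_shaped_floor_plan :: "'m set \<Rightarrow> ('m \<Rightarrow> rect) \<Rightarrow> bool" where
  "L_shaped_floor_plan M R \<longleftrightarrow> floor_plan M R \<and> num_concave_corners M R = 1"

text \<open>Stretching or shrinking one outer wall \<open>w\<close>: the module sides lying along \<open>w\<close> are all
  displaced by the same signed distance \<open>\<delta>\<close> perpendicularly to \<open>w\<close>, every other side stays on its
  line, and the result is a floor-plan with exactly the same adjacencies.\<close>

definition stretch :: "'m set \<Rightarrow> ('m \<Rightarrow> rect) \<Rightarrow> ('m \<Rightarrow> rect) \<Rightarrow> bool" where
  "stretch M R R' \<longleftrightarrow>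
     (\<exists>w \<delta>. boundary_wall (region M R) w \<and>
        (\<forall>i\<in>M. \<forall>e. R' i e = (if share_segment (side (R i) e) w then R i e + \<delta> else R i e))) \<and>
     floor_plan M R' \<and>
     (\<forall>i\<in>M. \<forall>j\<in>M. adjacent R' i j \<longleftrightarrow> adjacent R i j)"

definition trivial_plan :: "'m set \<Rightarrow> ('m \<Rightarrow> rect) \<Rightarrow> bool" where
  "trivial_plan M R \<longleftrightarrow>
     (\<exists>R'. (stretch M)\<^sup>*\<^sup>* R R' \<and> num_concave_corners M R' < num_concave_corners M R)"

text \<open>Walls leave the point \<open>p\<close> in all four axis directions (a crossing of walls). At the concave
  corner this means that both boundary walls meeting there are continued straight into the
  interior, so that the module diagonally opposite the notch meets the boundary near \<open>p\<close> in the
  single point \<open>p\<close> only.\<close>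

definition four_joint :: "'m set \<Rightarrow> ('m \<Rightarrow> rect) \<Rightarrow> real \<times> real \<Rightarrow> bool" where
  "four_joint M R p \<longleftrightarrow>
     (\<exists>\<epsilon>>0. \<forall>t. \<bar>t\<bar> < \<epsilon> \<longrightarrow>
        p + (t, 0) \<in> (\<Union>i\<in>M. \<Union>e. side (R i) e) \<and> p + (0, t) \<in> (\<Union>i\<in>M. \<Union>e. side (R i) e))"

end

theory Submission
  imports Defs
begin

text \<open>After reflections, the notch at the concave corner \<open>p\<close> points to the north-east, and, as \<open>p\<close> is not
  a four-joint, a single module \<open>B\<close> lies to the west of \<open>p\<close> on both sides of the height of \<open>p\<close>. A module
  \<open>A\<close> with its north-west corner at \<open>p\<close> lies to the right of \<open>B\<close>. Both sides of the equivalence hold iff \<open>B\<close>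
  does not reach the top of the vertical wall at \<open>p\<close>.

  If \<open>B\<close> reaches the top, no two modules along the walls at \<open>p\<close> are vertically adjacent, and raising
  the horizontal wall to the top turns the plan into a rectangle. Otherwise the module \<open>C\<close> on top
  of \<open>B\<close> completes the triple. Stretching preserves not only adjacency but also its direction, so in
  every plan reached \<open>A\<close> is right of \<open>B\<close> with nothing above it, \<open>C\<close> is above \<open>B\<close> with nothing right of it,
  and \<open>A\<close>, \<open>C\<close> are not adjacent; this forces a concave corner at the top of \<open>A\<close>, at the right end of \<open>C\<close>,
  or at the north-east corner of \<open>B\<close>.

  That the region really is an L: refine the plan to a grid. Since the frontier is a simple
  closed curve, it has no crossing points, so at every grid vertex except \<open>p\<close> two diagonally opposite
  filled cells force the other two. Following the rows up and down from \<open>p\<close> yields an L-shaped union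
  of cells that is both open and closed in the (connected) region.\<close>

section \<open>Arithmetic of sides and adjacencies\<close>

text \<open>The hypothesis excluding a four-joint at \<open>p\<close> has real content. When three
  unit squares form an L, the middle square meets the two walls only in \<open>p\<close>, so no
  triple exists. Yet with the middle square as \<open>B\<close> and the outer ones as
  \<open>A\<close> and \<open>C\<close>, the plan is non-trivial by
  \<open>blocked_corner_imp_nontrivial\<close>. Non-triviality speaks about every finite sequence of
  stretches, and the plans in between are not known to be L-shaped. The obstruction is therefore
  stated for plans with any number of concave corners, and it uses only which module lies right of
  or above which. For the shape of the region the obstacle is that \<open>floor_plan\<close>
  describes the outline purely topologically, as the image of some simple closed curve. Two
  consequences of this are exploited: the frontier has no branch point, which controls the region
  near each grid vertex, and it is connected, which excludes further components.\<close>

lemma share_segment_convex: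
  assumes "convex S" "convex T"
  shows "share_segment S T \<longleftrightarrow> (\<exists>a b. a \<noteq> b \<and> a \<in> S \<inter> T \<and> b \<in> S \<inter> T)"
proof -
  have "convex (S \<inter> T)"
    using assms by (rule convex_Int)
  then show ?thesis
    unfolding share_segment_def
    by (meson closed_segment_subset ends_in_segment subsetD)
qed

lemma share_segment_vertical:
  "share_segment ({x} \<times> {a..b}) ({x'} \<times> {c..d}) \<longleftrightarrow> x = x' \<and> max a c < min b (d::real)"
proof -
  have cv: "convex ({x} \<times> {a..b})" "convex ({x'} \<times> {c..d})"
    by (auto intro!: convex_Times)
  show ?thesis
    unfolding share_segment_convex[OF cv]
  proof
    assume "x = x' \<and> max a c < min b d"
    then show "\<exists>u v. u \<noteq> v \<and> u \<in> ({x} \<times> {a..b}) \<inter> ({x'} \<times> {c..d}) \<and>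
        v \<in> ({x} \<times> {a..b}) \<inter> ({x'} \<times> {c..d})"
      by (intro exI[of _ "(x, max a c)"] exI[of _ "(x, min b d)"]) auto
  qed (auto simp: max_def min_def)
qed

lemma share_segment_horizontal:
  "share_segment ({a..b} \<times> {y}) ({c..d} \<times> {y'}) \<longleftrightarrow> y = y' \<and> max a c < min b (d::real)"
proof -
  have cv: "convex ({a..b} \<times> {y})" "convex ({c..d} \<times> {y'})"
    by (auto intro!: convex_Times)
  show ?thesis
    unfolding share_segment_convex[OF cv]
  proof
    assume "y = y' \<and> max a c < min b d"
    then show "\<exists>u v. u \<noteq> v \<and> u \<in> ({a..b} \<times> {y}) \<inter> ({c..d} \<times> {y'}) \<and>
        v \<in> ({a..b} \<times> {y}) \<inter> ({c..d} \<times> {y'})"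
      by (intro exI[of _ "(max a c, y)"] exI[of _ "(min b d, y)"]) auto
  qed (auto simp: max_def min_def)
qed

lemma share_segment_commute: "share_segment S T \<longleftrightarrow> share_segment T S"
  by (simp add: share_segment_def Int_commute)

lemma share_segment_perpendicular:
  "\<not> share_segment ({x} \<times> I) (J \<times> {y})" "\<not> share_segment (J \<times> {y}) ({x} \<times> I)"
proof -
  show "\<not> share_segment ({x} \<times> I) (J \<times> {y})"
  proof
    assume "share_segment ({x} \<times> I) (J \<times> {y})"
    then obtain a b where ab: "a \<noteq> b" "closed_segment a b \<subseteq> ({x} \<times> I) \<inter> (J \<times> {y})"
      unfolding share_segment_def by blast
    then have "a \<in> ({x} \<times> I) \<inter> (J \<times> {y})" "b \<in> ({x} \<times> I) \<inter> (J \<times> {y})"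
      using ends_in_segment by blast+
    with ab(1) show False by auto
  qed
  then show "\<not> share_segment (J \<times> {y}) ({x} \<times> I)"
    by (simp add: share_segment_commute)
qed

text \<open>Separation along one of the axes. For nondegenerate rectangles it replaces disjoint
  interiors by linear inequalities, so that the later geometry can be left to linear
  arithmetic.\<close>

definition overlap_free :: "rect \<Rightarrow> rect \<Rightarrow> bool" where
  "overlap_free r s \<longleftrightarrow>
     r East \<le> s West \<or> s East \<le> r West \<or> r North \<le> s South \<or> s North \<le> r South"

lemma interior_rect_set:
  "interior (rect_set r) = {r West<..<r East} \<times> {r South<..<r North}"
  by (simp add: rect_set_def interior_Times)

lemma interiors_disjoint_iff:
  assumes "r West < r East" "r South < r North" "s West < s East" "s South < s North"
  shows "interior (rect_set r) \<inter> interior (rect_set s) = {} \<longleftrightarrow> overlap_free r s"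
proof
  assume e: "interior (rect_set r) \<inter> interior (rect_set s) = {}"
  show "overlap_free r s"
  proof (rule ccontr)
    assume "\<not> overlap_free r s"
    then have m: "max (r West) (s West) < min (r East) (s East)"
      "max (r South) (s South) < min (r North) (s North)"
      using assms by (auto simp: overlap_free_def)
    obtain x y where "max (r West) (s West) < x" "x < min (r East) (s East)"
      "max (r South) (s South) < y" "y < min (r North) (s North)"
      using dense[OF m(1)] dense[OF m(2)] by blast
    then have "(x, y) \<in> interior (rect_set r) \<inter> interior (rect_set s)"
      by (simp add: interior_rect_set)
    with e show False by blast
  qed
next
  assume "overlap_free r s"
  then show "interior (rect_set r) \<inter> interior (rect_set s) = {}"
    by (auto simp: interior_rect_set overlap_free_def)
qed

text \<open>The arithmetic half of \<open>floor_plan\<close>. With the frontier loop kept apart,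
  stretching can be analysed through coordinates alone.\<close>

definition valid_plan :: "'m set \<Rightarrow> ('m \<Rightarrow> rect) \<Rightarrow> bool" where
  "valid_plan M R \<longleftrightarrow> finite M \<and>
     (\<forall>i\<in>M. R i West < R i East \<and> R i South < R i North) \<and>
     (\<forall>i\<in>M. \<forall>j\<in>M. i \<noteq> j \<longrightarrow> overlap_free (R i) (R j))"

lemma floor_plan_iff:
  "floor_plan M R \<longleftrightarrow> valid_plan M R \<and>
     (\<exists>g. simple_path g \<and> pathfinish g = pathstart g \<and> path_image g = frontier (region M R))"
  unfolding floor_plan_def valid_plan_def by (simp add: interiors_disjoint_iff cong: conj_cong)

lemma valid_planD:
  assumes "valid_plan M R"
  shows "finite M" "i \<in> M \<Longrightarrow> R i West < R i East" "i \<in> M \<Longrightarrow> R i South < R i North"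
    "i \<in> M \<Longrightarrow> j \<in> M \<Longrightarrow> i \<noteq> j \<Longrightarrow>
      R i East \<le> R j West \<or> R j East \<le> R i West \<or> R i North \<le> R j South \<or> R j North \<le> R i South"
  using assms by (auto simp: valid_plan_def overlap_free_def)

text \<open>Adjacency in the statement is symmetric; here it is oriented, with \<open>j\<close> to
  the right of \<open>i\<close>. The orientation is the invariant of stretching on which
  non-triviality rests, and \<open>above\<close> plays the same role for the other axis.\<close>

definition right_of :: "('m \<Rightarrow> rect) \<Rightarrow> 'm \<Rightarrow> 'm \<Rightarrow> bool" where
  "right_of R j i \<longleftrightarrow> R i East = R j West \<and> R i South < R j North \<and> R j South < R i North"

definition above :: "('m \<Rightarrow> rect) \<Rightarrow> 'm \<Rightarrow> 'm \<Rightarrow> bool" where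
  "above R j i \<longleftrightarrow> R i North = R j South \<and> R i West < R j East \<and> R j West < R i East"

text \<open>Two modules with overlapping sides of the same kind, West with West or East with East,
  would have common interior points. Disjointness leaves only an East side against a West
  side.\<close>

lemma horizontally_adjacent_iff:
  assumes "valid_plan M R" "i \<in> M" "j \<in> M"
  shows "horizontally_adjacent R i j \<longleftrightarrow> right_of R j i \<or> right_of R i j"
proof -
  note pos = valid_planD(2,3)[OF assms(1) assms(2)] valid_planD(2,3)[OF assms(1) assms(3)]
  have eq: "horizontally_adjacent R i j \<longleftrightarrow> i \<noteq> j \<and>
      (R i West = R j West \<or> R i West = R j East \<or> R i East = R j West \<or> R i East = R j East) \<and>
      R i South < R j North \<and> R j South < R i North"
    using pos by (simp add: horizontally_adjacent_def share_segment_vertical) blast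
  show ?thesis
    unfolding eq right_of_def using pos valid_planD(4)[OF assms] by (smt (verit))
qed

lemma vertically_adjacent_iff:
  assumes "valid_plan M R" "i \<in> M" "j \<in> M"
  shows "vertically_adjacent R i j \<longleftrightarrow> above R j i \<or> above R i j"
proof -
  note pos = valid_planD(2,3)[OF assms(1) assms(2)] valid_planD(2,3)[OF assms(1) assms(3)]
  have eq: "vertically_adjacent R i j \<longleftrightarrow> i \<noteq> j \<and>
      (R i South = R j South \<or> R i South = R j North \<or> R i North = R j South \<or> R i North = R j North) \<and>
      R i West < R j East \<and> R j West < R i East"
    using pos by (simp add: vertically_adjacent_def share_segment_horizontal) blast
  show ?thesis
    unfolding eq above_def using pos valid_planD(4)[OF assms] by (smt (verit))
qed

lemma closed_segment_vertical: "closed_segment (x, a) (x, b) = {x} \<times> closed_segment a (b::real)"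
  for x :: real
  by (auto simp: closed_segment_def simp flip: distrib_right)

lemma closed_segment_horizontal: "closed_segment (a, y) (b, y) = closed_segment a (b::real) \<times> {y}"
  for y :: real
  by (auto simp: closed_segment_def simp flip: distrib_right)

lemma boundary_wall_cases:
  assumes "boundary_wall P w"
  obtains (vertical) x c d where "c < d" "w = {x} \<times> {c..d}"
  | (horizontal) y c d where "c < d" "w = {c..d} \<times> {y}"
proof -
  obtain a b where ab: "a \<noteq> b" "fst a = fst b \<or> snd a = snd b" and w: "w = closed_segment a b"
    using assms unfolding boundary_wall_def by blast
  obtain a1 a2 b1 b2 where e: "a = (a1, a2)" "b = (b1, b2)"
    by (cases a, cases b)
  show thesis
  proof (cases "a1 = b1")
    case True
    have "w = {a1} \<times> {min a2 b2..max a2 b2}"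
      unfolding w e using True
      by (simp add: closed_segment_vertical closed_segment_eq_real_ivl min_def max_def)
    moreover have "min a2 b2 < max a2 b2" using ab True e by auto
    ultimately show thesis using vertical by blast
  next
    case False
    with ab e have "a2 = b2" by simp
    then have "w = {min a1 b1..max a1 b1} \<times> {a2}"
      unfolding w e
      by (simp add: closed_segment_horizontal closed_segment_eq_real_ivl min_def max_def)
    moreover have "min a1 b1 < max a1 b1" using False by auto
    ultimately show thesis using horizontal by blast
  qed
qed

section \<open>Stretching preserves the directions of adjacencies\<close>

lemma share_segment_side_vertical:
  assumes "share_segment (side r e) ({x} \<times> {c..d})"
  shows "e \<in> {West, East}" "r e = x"
  using assms by (cases e; simp add: share_segment_vertical share_segment_perpendicular)+

lemma share_segment_side_horizontal:
  assumes "share_segment (side r e) ({c..d} \<times> {y})"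
  shows "e \<in> {South, North}" "r e = y"
  using assms by (cases e; simp add: share_segment_horizontal share_segment_perpendicular)+

lemma adjacent_iff:
  assumes "valid_plan M R" "i \<in> M" "j \<in> M"
  shows "adjacent R i j \<longleftrightarrow> right_of R j i \<or> right_of R i j \<or> above R j i \<or> above R i j"
  using horizontally_adjacent_iff[OF assms] vertically_adjacent_iff[OF assms]
  by (auto simp: adjacent_def)

text \<open>Of the moved wall only this much is kept: the moved sides are parallel, lie on one line
  and are displaced by the same \<open>d\<close>. The predicate \<open>m\<close> tells which sides
  on that line move.\<close>

lemma stretch_cases:
  assumes "stretch M R R'"
  obtains (vertical) x m d where
    "\<And>i e. i \<in> M \<Longrightarrow> R' i e = (if m i e then R i e + d else R i e)"
    "\<And>i e. m i e \<Longrightarrow> e \<in> {West, East} \<and> R i e = x"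
  | (horizontal) y m d where
    "\<And>i e. i \<in> M \<Longrightarrow> R' i e = (if m i e then R i e + d else R i e)"
    "\<And>i e. m i e \<Longrightarrow> e \<in> {South, North} \<and> R i e = y"
proof -
  obtain w \<delta> where w: "boundary_wall (region M R) w"
    and R': "\<And>i e. i \<in> M \<Longrightarrow> R' i e = (if share_segment (side (R i) e) w then R i e + \<delta> else R i e)"
    using assms unfolding stretch_def by blast
  from w show thesis
  proof (cases rule: boundary_wall_cases)
    case (vertical x c d)
    have "e \<in> {West, East} \<and> R i e = x" if "share_segment (side (R i) e) w" for i e
      using that share_segment_side_vertical unfolding vertical(2) by blast
    with R' show thesis by (rule that(1))
  next
    case (horizontal y c d)
    have "e \<in> {South, North} \<and> R i e = y" if "share_segment (side (R i) e) w" for i e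
      using that share_segment_side_horizontal unfolding horizontal(2) by blast
    with R' show thesis by (rule that(2))
  qed
qed

text \<open>If a vertical wall moves, the vertical overlap of the two modules stays and excludes
  \<open>above\<close>. Opposite sides of a module lie on different lines, so at most one of them
  moves, and exchanging left and right would turn a module inside out. If a horizontal wall moves,
  the common vertical line stays and excludes every other kind of contact.\<close>

lemma stretch_right_of:
  assumes V: "valid_plan M R" and V': "valid_plan M R'" and st: "stretch M R R'"
    and ij: "i \<in> M" "j \<in> M" "right_of R j i"
  shows "right_of R' j i"
proof -
  note pos = valid_planD(2,3)[OF V ij(1)] valid_planD(2,3)[OF V ij(2)]
  note pos' = valid_planD(2,3)[OF V' ij(1)] valid_planD(2,3)[OF V' ij(2)]
  have "adjacent R' i j"
    using st ij adjacent_iff[OF V ij(1,2)] unfolding stretch_def by blast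
  then have adj: "right_of R' j i \<or> right_of R' i j \<or> above R' j i \<or> above R' i j"
    using adjacent_iff[OF V' ij(1,2)] by blast
  from st show ?thesis
  proof (cases rule: stretch_cases)
    case (vertical x m d)
    have ns: "R' k South = R k South" "R' k North = R k North" if "k \<in> M" for k
      using vertical(1)[OF that] vertical(2) by auto
    have m: "m k e \<Longrightarrow> R k e = x" for k e
      using vertical(2) by blast
    note R' = vertical(1)[OF ij(1), of East] vertical(1)[OF ij(1), of West]
      vertical(1)[OF ij(2), of East] vertical(1)[OF ij(2), of West]
    note mm = m[of i East] m[of i West] m[of j East] m[of j West]
    have "\<not> right_of R' i j"
      using R' mm pos pos' ij(3) unfolding right_of_def by (smt (verit))
    moreover have "\<not> above R' j i" "\<not> above R' i j"
      using ns[OF ij(1)] ns[OF ij(2)] ij(3) pos unfolding right_of_def above_def by linarith+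
    ultimately show ?thesis using adj by blast
  next
    case (horizontal y m d)
    have we: "R' k West = R k West" "R' k East = R k East" if "k \<in> M" for k
      using horizontal(1)[OF that] horizontal(2) by auto
    show ?thesis
      using adj we[OF ij(1)] we[OF ij(2)] ij(3) pos pos' unfolding right_of_def above_def
      by linarith
  qed
qed

lemma stretch_above:
  assumes V: "valid_plan M R" and V': "valid_plan M R'" and st: "stretch M R R'"
    and ij: "i \<in> M" "j \<in> M" "above R j i"
  shows "above R' j i"
proof -
  note pos = valid_planD(2,3)[OF V ij(1)] valid_planD(2,3)[OF V ij(2)]
  note pos' = valid_planD(2,3)[OF V' ij(1)] valid_planD(2,3)[OF V' ij(2)]
  have "adjacent R' i j"
    using st ij adjacent_iff[OF V ij(1,2)] unfolding stretch_def by blast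
  then have adj: "right_of R' j i \<or> right_of R' i j \<or> above R' j i \<or> above R' i j"
    using adjacent_iff[OF V' ij(1,2)] by blast
  from st show ?thesis
  proof (cases rule: stretch_cases)
    case (horizontal x m d)
    have we: "R' k West = R k West" "R' k East = R k East" if "k \<in> M" for k
      using horizontal(1)[OF that] horizontal(2) by auto
    have m: "m k e \<Longrightarrow> R k e = x" for k e
      using horizontal(2) by blast
    note R' = horizontal(1)[OF ij(1), of North] horizontal(1)[OF ij(1), of South]
      horizontal(1)[OF ij(2), of North] horizontal(1)[OF ij(2), of South]
    note mm = m[of i North] m[of i South] m[of j North] m[of j South]
    have "\<not> above R' i j"
      using R' mm pos pos' ij(3) unfolding above_def by (smt (verit))
    moreover have "\<not> right_of R' j i" "\<not> right_of R' i j"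
      using we[OF ij(1)] we[OF ij(2)] ij(3) pos unfolding right_of_def above_def by linarith+
    ultimately show ?thesis using adj by blast
  next
    case (vertical y m d)
    have ns: "R' k South = R k South" "R' k North = R k North" if "k \<in> M" for k
      using vertical(1)[OF that] vertical(2) by auto
    show ?thesis
      using adj ns[OF ij(1)] ns[OF ij(2)] ij(3) pos pos' unfolding right_of_def above_def
      by linarith
  qed
qed

text \<open>The equivalences, not just implications, are needed because the obstruction also
  contains negative facts such as "nothing lies above \<open>A\<close>". They follow since adjacency
  is preserved as a whole, each oriented contact survives, and the oriented contacts exclude one
  another.\<close>

lemma stretches_preserve:
  assumes "(stretch M)\<^sup>*\<^sup>* R R'" and "valid_plan M R"
  shows "valid_plan M R' \<and> (\<forall>i\<in>M. \<forall>j\<in>M. (right_of R' j i \<longleftrightarrow> right_of R j i) \<and>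
    (above R' j i \<longleftrightarrow> above R j i))"
  using assms
proof (induction rule: rtranclp_induct)
  case (step S S')
  then have V: "valid_plan M S" and IH: "\<And>i j. i \<in> M \<Longrightarrow> j \<in> M \<Longrightarrow> right_of S j i \<longleftrightarrow> right_of R j i"
    "\<And>i j. i \<in> M \<Longrightarrow> j \<in> M \<Longrightarrow> above S j i \<longleftrightarrow> above R j i"
    by blast+
  have V': "valid_plan M S'"
    using step.hyps(2) by (simp add: stretch_def floor_plan_iff)
  have fwd: "right_of S j i \<Longrightarrow> right_of S' j i" "above S j i \<Longrightarrow> above S' j i"
    if "i \<in> M" "j \<in> M" for i j
    using stretch_right_of[OF V V' step.hyps(2) that] stretch_above[OF V V' step.hyps(2) that]
    by blast+
  have adj: "right_of S j i \<or> right_of S i j \<or> above S j i \<or> above S i j"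
    if "i \<in> M" "j \<in> M" "right_of S' j i \<or> above S' j i" for i j
  proof -
    have "adjacent S' i j" using adjacent_iff[OF V' that(1,2)] that(3) by blast
    then show ?thesis
      using step.hyps(2) that adjacent_iff[OF V that(1,2)] unfolding stretch_def by blast
  qed
  have excl: "right_of S' j i \<Longrightarrow> \<not> right_of S' i j \<and> \<not> above S' j i \<and> \<not> above S' i j"
    "above S' j i \<Longrightarrow> \<not> above S' i j \<and> \<not> right_of S' j i \<and> \<not> right_of S' i j"
    if "i \<in> M" "j \<in> M" for i j
    using valid_planD(2,3)[OF V' that(1)] valid_planD(2,3)[OF V' that(2)]
    unfolding right_of_def above_def by linarith+
  have "right_of S' j i \<longleftrightarrow> right_of S j i" "above S' j i \<longleftrightarrow> above S j i"
    if "i \<in> M" "j \<in> M" for i j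
    using fwd[OF that] fwd[OF that(2,1)] adj[OF that] excl[OF that] by blast+
  then show ?case using V' IH by simp
qed simp

text \<open>Near \<open>(x, y)\<close> each open quadrant is either contained in the region or disjoint from it; the
  mixture of strict and weak inequalities expresses the former.\<close>

definition filled_ne :: "'m set \<Rightarrow> ('m \<Rightarrow> rect) \<Rightarrow> real \<Rightarrow> real \<Rightarrow> bool" where
  "filled_ne M R x y \<longleftrightarrow>
     (\<exists>i\<in>M. R i West \<le> x \<and> x < R i East \<and> R i South \<le> y \<and> y < R i North)"

definition filled_nw :: "'m set \<Rightarrow> ('m \<Rightarrow> rect) \<Rightarrow> real \<Rightarrow> real \<Rightarrow> bool" where
  "filled_nw M R x y \<longleftrightarrow>
     (\<exists>i\<in>M. R i West < x \<and> x \<le> R i East \<and> R i South \<le> y \<and> y < R i North)"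

definition filled_se :: "'m set \<Rightarrow> ('m \<Rightarrow> rect) \<Rightarrow> real \<Rightarrow> real \<Rightarrow> bool" where
  "filled_se M R x y \<longleftrightarrow>
     (\<exists>i\<in>M. R i West \<le> x \<and> x < R i East \<and> R i South < y \<and> y \<le> R i North)"

definition filled_sw :: "'m set \<Rightarrow> ('m \<Rightarrow> rect) \<Rightarrow> real \<Rightarrow> real \<Rightarrow> bool" where
  "filled_sw M R x y \<longleftrightarrow>
     (\<exists>i\<in>M. R i West < x \<and> x \<le> R i East \<and> R i South < y \<and> y \<le> R i North)"

section \<open>The shape of the region near a point\<close>

lemma mem_region:
  "(x, y) \<in> region M R \<longleftrightarrow>
     (\<exists>i\<in>M. R i West \<le> x \<and> x \<le> R i East \<and> R i South \<le> y \<and> y \<le> R i North)"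
  by (auto simp: region_def rect_set_def)

lemma finite_coordinates_gap:
  fixes x :: real and R :: "'m \<Rightarrow> rect"
  assumes "finite M"
  obtains \<epsilon> where "\<epsilon> > 0" "\<And>i e. i \<in> M \<Longrightarrow> R i e \<noteq> x \<Longrightarrow> \<epsilon> \<le> \<bar>R i e - x\<bar>"
proof -
  have "finite ((\<lambda>(i, e). R i e) ` (M \<times> {West, East, South, North}))"
    using assms by blast
  then obtain d where d: "d > 0"
    "\<And>z. z \<in> (\<lambda>(i, e). R i e) ` (M \<times> {West, East, South, North}) \<Longrightarrow> z \<noteq> x \<Longrightarrow> d \<le> dist x z"
    using finite_set_avoid[of _ x] by metis
  have "e \<in> {West, East, South, North}" for e by (cases e) auto
  then have "d \<le> \<bar>R i e - x\<bar>" if "i \<in> M" "R i e \<noteq> x" for i e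
    using d(2)[of "R i e"] that by (force simp: dist_real_def abs_minus_commute)
  with d(1) that show thesis by blast
qed

text \<open>Below the least distance to any other coordinate, comparing \<open>x + u\<close> with a
  side depends only on the sign of \<open>u\<close> and the position of \<open>x\<close>. The
  quadrants are closed because modules are, so a point on an axis belongs to two of them.\<close>

lemma region_local:
  assumes V: "valid_plan M R"
  obtains \<epsilon> where "\<epsilon> > 0" "\<And>u v. \<bar>u\<bar> < \<epsilon> \<Longrightarrow> \<bar>v\<bar> < \<epsilon> \<Longrightarrow> (x + u, y + v) \<in> region M R \<longleftrightarrow>
      u \<ge> 0 \<and> v \<ge> 0 \<and> filled_ne M R x y \<or> u \<le> 0 \<and> v \<ge> 0 \<and> filled_nw M R x y \<or>
      u \<ge> 0 \<and> v \<le> 0 \<and> filled_se M R x y \<or> u \<le> 0 \<and> v \<le> 0 \<and> filled_sw M R x y"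
proof -
  obtain d where d: "d > 0" "\<And>i e. i \<in> M \<Longrightarrow> R i e \<noteq> x \<Longrightarrow> d \<le> \<bar>R i e - x\<bar>"
    using finite_coordinates_gap[of M R x] valid_planD(1)[OF V] by metis
  obtain d' where d': "d' > 0" "\<And>i e. i \<in> M \<Longrightarrow> R i e \<noteq> y \<Longrightarrow> d' \<le> \<bar>R i e - y\<bar>"
    using finite_coordinates_gap[of M R y] valid_planD(1)[OF V] by metis
  show thesis
  proof (rule that[of "min d d'"])
    fix u v :: real
    assume "\<bar>u\<bar> < min d d'" "\<bar>v\<bar> < min d d'"
    then have uv: "\<bar>u\<bar> < d" "\<bar>v\<bar> < d'" by auto
    have X: "R i West \<le> x + u \<and> x + u \<le> R i East \<longleftrightarrow>
        u \<ge> 0 \<and> R i West \<le> x \<and> x < R i East \<or> u \<le> 0 \<and> R i West < x \<and> x \<le> R i East" if "i \<in> M" for i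
      using d(2)[OF that, of West] d(2)[OF that, of East] uv(1) valid_planD(2)[OF V that]
      by (smt (verit))
    have Y: "R i South \<le> y + v \<and> y + v \<le> R i North \<longleftrightarrow>
        v \<ge> 0 \<and> R i South \<le> y \<and> y < R i North \<or> v \<le> 0 \<and> R i South < y \<and> y \<le> R i North" if "i \<in> M" for i
      using d'(2)[OF that, of South] d'(2)[OF that, of North] uv(2) valid_planD(3)[OF V that]
      by (smt (verit))
    have "(x + u, y + v) \<in> region M R \<longleftrightarrow> (\<exists>i\<in>M.
        (u \<ge> 0 \<and> R i West \<le> x \<and> x < R i East \<or> u \<le> 0 \<and> R i West < x \<and> x \<le> R i East) \<and>
        (v \<ge> 0 \<and> R i South \<le> y \<and> y < R i North \<or> v \<le> 0 \<and> R i South < y \<and> y \<le> R i North))"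
      unfolding mem_region using X Y by blast
    then show "(x + u, y + v) \<in> region M R \<longleftrightarrow>
      u \<ge> 0 \<and> v \<ge> 0 \<and> filled_ne M R x y \<or> u \<le> 0 \<and> v \<ge> 0 \<and> filled_nw M R x y \<or>
      u \<ge> 0 \<and> v \<le> 0 \<and> filled_se M R x y \<or> u \<le> 0 \<and> v \<le> 0 \<and> filled_sw M R x y"
      unfolding filled_ne_def filled_nw_def filled_se_def filled_sw_def by blast
  qed (use d d' in auto)
qed

text \<open>The direction of the notch is kept as a pair of signs, on which the symmetries act
  later.\<close>

definition concave_towards :: "real \<Rightarrow> real \<Rightarrow> (real \<times> real) set \<Rightarrow> real \<times> real \<Rightarrow> bool" where
  "concave_towards sx sy P p \<longleftrightarrow> (\<exists>\<epsilon>>0. \<forall>u v. \<bar>u\<bar> < \<epsilon> \<and> \<bar>v\<bar> < \<epsilon> \<longrightarrow>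
        (p + (u, v) \<in> P \<longleftrightarrow> \<not> (sx * u > 0 \<and> sy * v > 0)))"

lemma concave_corner_iff:
  "concave_corner P p \<longleftrightarrow> (\<exists>sx\<in>{-1, 1}. \<exists>sy\<in>{-1, 1}. concave_towards sx sy P p)"
  by (simp add: concave_corner_def concave_towards_def)

text \<open>Near the point, three closed quadrants cover everything except the fourth open
  one.\<close>

lemma three_filled_imp_concave:
  assumes V: "valid_plan M R"
    and "filled_ne M R x y \<and> filled_nw M R x y \<and> filled_se M R x y \<and> \<not> filled_sw M R x y \<or>
      filled_ne M R x y \<and> filled_nw M R x y \<and> \<not> filled_se M R x y \<and> filled_sw M R x y \<or>
      filled_ne M R x y \<and> \<not> filled_nw M R x y \<and> filled_se M R x y \<and> filled_sw M R x y \<or>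
      \<not> filled_ne M R x y \<and> filled_nw M R x y \<and> filled_se M R x y \<and> filled_sw M R x y"
  shows "concave_corner (region M R) (x, y)"
proof -
  obtain \<epsilon> where e: "\<epsilon> > 0" "\<And>u v. \<bar>u\<bar> < \<epsilon> \<Longrightarrow> \<bar>v\<bar> < \<epsilon> \<Longrightarrow> (x + u, y + v) \<in> region M R \<longleftrightarrow>
      u \<ge> 0 \<and> v \<ge> 0 \<and> filled_ne M R x y \<or> u \<le> 0 \<and> v \<ge> 0 \<and> filled_nw M R x y \<or>
      u \<ge> 0 \<and> v \<le> 0 \<and> filled_se M R x y \<or> u \<le> 0 \<and> v \<le> 0 \<and> filled_sw M R x y"
    using region_local[OF V] by blast
  have conc: "concave_towards sx sy (region M R) (x, y)"
    if "\<And>u v. \<bar>u\<bar> < \<epsilon> \<Longrightarrow> \<bar>v\<bar> < \<epsilon> \<Longrightarrow> (x + u, y + v) \<in> region M R \<longleftrightarrow> \<not> (sx * u > 0 \<and> sy * v > 0)"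
    for sx sy
    unfolding concave_towards_def using that e(1) by auto
  from assms(2) show ?thesis
    unfolding concave_corner_iff
  proof (elim disjE)
    assume "filled_ne M R x y \<and> filled_nw M R x y \<and> filled_se M R x y \<and> \<not> filled_sw M R x y"
    then have "concave_towards (-1) (-1) (region M R) (x, y)"
      by (intro conc) (auto simp: e(2))
    then show "\<exists>sx\<in>{- 1, 1}. \<exists>sy\<in>{- 1, 1}. concave_towards sx sy (region M R) (x, y)" by blast
  next
    assume "filled_ne M R x y \<and> filled_nw M R x y \<and> \<not> filled_se M R x y \<and> filled_sw M R x y"
    then have "concave_towards 1 (-1) (region M R) (x, y)"
      by (intro conc) (auto simp: e(2))
    then show "\<exists>sx\<in>{- 1, 1}. \<exists>sy\<in>{- 1, 1}. concave_towards sx sy (region M R) (x, y)" by blast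
  next
    assume "filled_ne M R x y \<and> \<not> filled_nw M R x y \<and> filled_se M R x y \<and> filled_sw M R x y"
    then have "concave_towards (-1) 1 (region M R) (x, y)"
      by (intro conc) (auto simp: e(2))
    then show "\<exists>sx\<in>{- 1, 1}. \<exists>sy\<in>{- 1, 1}. concave_towards sx sy (region M R) (x, y)" by blast
  next
    assume "\<not> filled_ne M R x y \<and> filled_nw M R x y \<and> filled_se M R x y \<and> filled_sw M R x y"
    then have "concave_towards 1 1 (region M R) (x, y)"
      by (intro conc) (auto simp: e(2))
    then show "\<exists>sx\<in>{- 1, 1}. \<exists>sy\<in>{- 1, 1}. concave_towards sx sy (region M R) (x, y)" by blast
  qed
qed

lemma concave_ne_filled:
  assumes V: "valid_plan M R" and c: "concave_towards 1 1 (region M R) (x, y)"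
  shows "\<not> filled_ne M R x y" "filled_nw M R x y" "filled_se M R x y" "filled_sw M R x y"
proof -
  obtain \<epsilon> where e: "\<epsilon> > 0" "\<And>u v. \<bar>u\<bar> < \<epsilon> \<Longrightarrow> \<bar>v\<bar> < \<epsilon> \<Longrightarrow> (x + u, y + v) \<in> region M R \<longleftrightarrow>
      u \<ge> 0 \<and> v \<ge> 0 \<and> filled_ne M R x y \<or> u \<le> 0 \<and> v \<ge> 0 \<and> filled_nw M R x y \<or>
      u \<ge> 0 \<and> v \<le> 0 \<and> filled_se M R x y \<or> u \<le> 0 \<and> v \<le> 0 \<and> filled_sw M R x y"
    using region_local[OF V] by blast
  obtain \<epsilon>' where e': "\<epsilon>' > 0" "\<And>u v. \<bar>u\<bar> < \<epsilon>' \<Longrightarrow> \<bar>v\<bar> < \<epsilon>' \<Longrightarrow>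
      (x + u, y + v) \<in> region M R \<longleftrightarrow> \<not> (u > 0 \<and> v > 0)"
    using c unfolding concave_towards_def by auto
  \<comment> \<open>Small enough for both local descriptions; each of the four points with offsets
    \<open>h\<close> or \<open>- h\<close> then tests one open quadrant.\<close>
  define h where "h = min \<epsilon> \<epsilon>' / 2"
  have h: "h > 0" "h < \<epsilon>" "h < \<epsilon>'" unfolding h_def using e(1) e'(1) by auto
  show "\<not> filled_ne M R x y" using e(2)[of h h] e'(2)[of h h] h by auto
  show "filled_nw M R x y" using e(2)[of "-h" h] e'(2)[of "-h" h] h by auto
  show "filled_se M R x y" using e(2)[of h "-h"] e'(2)[of h "-h"] h by auto
  show "filled_sw M R x y" using e(2)[of "-h" "-h"] e'(2)[of "-h" "-h"] h by auto
qed

text \<open>Away from the lines carrying module sides the region is locally a product with an interval,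
  which a concave corner is not.\<close>

lemma concave_corner_coordinates:
  assumes V: "valid_plan M R" and c: "concave_corner (region M R) (x, y)"
  shows "\<exists>i\<in>M. x \<in> {R i West, R i East}" "\<exists>i\<in>M. y \<in> {R i South, R i North}"
proof -
  obtain \<epsilon> where e: "\<epsilon> > 0" "\<And>u v. \<bar>u\<bar> < \<epsilon> \<Longrightarrow> \<bar>v\<bar> < \<epsilon> \<Longrightarrow> (x + u, y + v) \<in> region M R \<longleftrightarrow>
      u \<ge> 0 \<and> v \<ge> 0 \<and> filled_ne M R x y \<or> u \<le> 0 \<and> v \<ge> 0 \<and> filled_nw M R x y \<or>
      u \<ge> 0 \<and> v \<le> 0 \<and> filled_se M R x y \<or> u \<le> 0 \<and> v \<le> 0 \<and> filled_sw M R x y"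
    using region_local[OF V] by blast
  obtain sx sy where s: "sx \<in> {-1, 1}" "sy \<in> {-1, 1}"
    and "concave_towards sx sy (region M R) (x, y)"
    using c unfolding concave_corner_iff by blast
  then obtain \<epsilon>' where e': "\<epsilon>' > 0" "\<And>u v. \<bar>u\<bar> < \<epsilon>' \<Longrightarrow> \<bar>v\<bar> < \<epsilon>' \<Longrightarrow>
      (x + u, y + v) \<in> region M R \<longleftrightarrow> \<not> (sx * u > 0 \<and> sy * v > 0)"
    unfolding concave_towards_def by auto
  define h where "h = min \<epsilon> \<epsilon>' / 2"
  have h: "h > 0" "h < \<epsilon>" "h < \<epsilon>'" unfolding h_def using e(1) e'(1) by auto
  have eq: "filled_ne M R x y \<longleftrightarrow> \<not> (sx * h > 0 \<and> sy * h > 0)"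
    "filled_nw M R x y \<longleftrightarrow> \<not> (sx * -h > 0 \<and> sy * h > 0)"
    "filled_se M R x y \<longleftrightarrow> \<not> (sx * h > 0 \<and> sy * -h > 0)"
    "filled_sw M R x y \<longleftrightarrow> \<not> (sx * -h > 0 \<and> sy * -h > 0)"
    using e(2)[of h h] e'(2)[of h h] e(2)[of "-h" h] e'(2)[of "-h" h]
      e(2)[of h "-h"] e'(2)[of h "-h"] e(2)[of "-h" "-h"] e'(2)[of "-h" "-h"] h by auto
  \<comment> \<open>Exactly one quadrant is empty, so the filling changes somewhere across either
    axis.\<close>
  have ne: "filled_ne M R x y \<noteq> filled_nw M R x y \<or> filled_se M R x y \<noteq> filled_sw M R x y"
    "filled_ne M R x y \<noteq> filled_se M R x y \<or> filled_nw M R x y \<noteq> filled_sw M R x y"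
    unfolding eq using s h(1) by auto
  show "\<exists>i\<in>M. x \<in> {R i West, R i East}"
  proof (rule ccontr)
    assume "\<not> ?thesis"
    then have "(R i West \<le> x \<longleftrightarrow> R i West < x) \<and> (x < R i East \<longleftrightarrow> x \<le> R i East)" if "i \<in> M" for i
      using that by force
    then have "filled_ne M R x y = filled_nw M R x y \<and> filled_se M R x y = filled_sw M R x y"
      unfolding filled_ne_def filled_nw_def filled_se_def filled_sw_def
      by blast
    with ne(1) show False by blast
  qed
  show "\<exists>i\<in>M. y \<in> {R i South, R i North}"
  proof (rule ccontr)
    assume "\<not> ?thesis"
    then have "(R i South \<le> y \<longleftrightarrow> R i South < y) \<and> (y < R i North \<longleftrightarrow> y \<le> R i North)" if "i \<in> M" for i
      using that by force
    then have "filled_ne M R x y = filled_se M R x y \<and> filled_nw M R x y = filled_sw M R x y"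
      unfolding filled_ne_def filled_nw_def filled_se_def filled_sw_def
      by blast
    with ne(2) show False by blast
  qed
qed

section \<open>Concave corners that stretching cannot remove\<close>

lemma finite_concave_corners:
  assumes V: "valid_plan M R"
  shows "finite {p. concave_corner (region M R) p}"
proof (rule finite_subset)
  show "{p. concave_corner (region M R) p} \<subseteq>
      (\<Union>i\<in>M. {R i West, R i East}) \<times> (\<Union>i\<in>M. {R i South, R i North})"
  proof
    fix p assume "p \<in> {p. concave_corner (region M R) p}"
    then have "concave_corner (region M R) (fst p, snd p)" by simp
    from concave_corner_coordinates[OF V this]
    show "p \<in> (\<Union>i\<in>M. {R i West, R i East}) \<times> (\<Union>i\<in>M. {R i South, R i North})"
      by (simp add: mem_Times_iff)
  qed
  show "finite ((\<Union>i\<in>M. {R i West, R i East}) \<times> (\<Union>i\<in>M. {R i South, R i North}))"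
    using valid_planD(1)[OF V] by blast
qed

text \<open>Comparing the top of \<open>A\<close> and the right end of \<open>C\<close> with
  \<open>B\<close> gives three cases. In each of them the given modules fill three quadrants at the
  proposed corner. A module in the fourth, being disjoint from \<open>A\<close> and
  \<open>C\<close>, would have to lie above \<open>A\<close> or to the right of
  \<open>C\<close>.\<close>

lemma blocked_corner_imp_concave:
  assumes V: "valid_plan M R" and M: "A \<in> M" "B \<in> M" "C \<in> M"
    and AB: "right_of R A B" and CB: "above R C B"
    and A: "\<And>D. D \<in> M \<Longrightarrow> \<not> above R D A" and C: "\<And>D. D \<in> M \<Longrightarrow> \<not> right_of R D C"
    and AC: "\<not> right_of R A C" "\<not> above R C A"
  shows "\<exists>p. concave_corner (region M R) p"
proof -
  note pos = valid_planD(2,3)[OF V]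
  note facts = AB[unfolded right_of_def] CB[unfolded above_def] pos[OF M(1)] pos[OF M(2)] pos[OF M(3)]
  have A': "\<not> (R A North = R D South \<and> R A West < R D East \<and> R D West < R A East)" if "D \<in> M" for D
    using A[OF that] by (auto simp: above_def)
  have C': "\<not> (R C East = R D West \<and> R C South < R D North \<and> R D South < R C North)" if "D \<in> M" for D
    using C[OF that] by (auto simp: right_of_def)
  have conc: "\<exists>p. concave_corner (region M R) p"
    if "filled_nw M R x y" "filled_se M R x y" "filled_sw M R x y" "\<not> filled_ne M R x y" for x y
    using that three_filled_imp_concave[OF V, of x y] by blast
  have AC': "\<not> (R C East = R A West \<and> R C South < R A North \<and> R A South < R C North)"
    "\<not> (R A North = R C South \<and> R A West < R C East \<and> R C West < R A East)"
    using AC by (auto simp: right_of_def above_def)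
  have "A \<noteq> C" using facts by auto
  note ov = valid_planD(4)[OF V M(1) M(3) this]
  consider "R A North < R B North" | "R C East < R B East"
    | "R A North \<ge> R B North" "R C East \<ge> R B East" by linarith
  then show ?thesis
  proof cases
    case 1
    show ?thesis
    proof (rule conc[of "R B East" "R A North"])
      show "filled_nw M R (R B East) (R A North)"
        unfolding filled_nw_def using M(2) facts 1 by (intro bexI[of _ B]) auto
      show "filled_sw M R (R B East) (R A North)"
        unfolding filled_sw_def using M(2) facts 1 by (intro bexI[of _ B]) auto
      show "filled_se M R (R B East) (R A North)"
        unfolding filled_se_def using M(1) facts 1 by (intro bexI[of _ A]) auto
      show "\<not> filled_ne M R (R B East) (R A North)"
      proof
        assume "filled_ne M R (R B East) (R A North)"
        then obtain D where D: "D \<in> M" "R D West \<le> R B East" "R B East < R D East"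
          "R D South \<le> R A North" "R A North < R D North"
          unfolding filled_ne_def by blast
        have "D \<noteq> A" using D by auto
        show False
          using valid_planD(4)[OF V D(1) M(1) \<open>D \<noteq> A\<close>] A'[OF D(1)] D facts pos[OF D(1)] by linarith
      qed
    qed
  next
    case 2
    show ?thesis
    proof (rule conc[of "R C East" "R B North"])
      show "filled_nw M R (R C East) (R B North)"
        unfolding filled_nw_def using M(3) facts 2 by (intro bexI[of _ C]) auto
      show "filled_sw M R (R C East) (R B North)"
        unfolding filled_sw_def using M(2) facts 2 by (intro bexI[of _ B]) auto
      show "filled_se M R (R C East) (R B North)"
        unfolding filled_se_def using M(2) facts 2 by (intro bexI[of _ B]) auto
      show "\<not> filled_ne M R (R C East) (R B North)"
      proof
        assume "filled_ne M R (R C East) (R B North)"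
        then obtain D where D: "D \<in> M" "R D West \<le> R C East" "R C East < R D East"
          "R D South \<le> R B North" "R B North < R D North"
          unfolding filled_ne_def by blast
        have "D \<noteq> C" using D by auto
        show False
          using valid_planD(4)[OF V D(1) M(3) \<open>D \<noteq> C\<close>] C'[OF D(1)] D facts pos[OF D(1)] by linarith
      qed
    qed
  next
    case 3
    \<comment> \<open>\<open>A\<close> reaches at least the top of \<open>B\<close>, and
      \<open>C\<close> at least its right side. Being disjoint and without contact, neither can go
      further, so all three meet at the north-east corner of \<open>B\<close>.\<close>
    have eq: "R A North = R B North" "R C East = R B East"
      using 3 facts ov AC' by linarith+
    show ?thesis
    proof (rule conc[of "R B East" "R B North"])
      show "filled_nw M R (R B East) (R B North)"
        unfolding filled_nw_def using M(3) facts eq by (intro bexI[of _ C]) auto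
      show "filled_sw M R (R B East) (R B North)"
        unfolding filled_sw_def using M(2) facts eq by (intro bexI[of _ B]) auto
      show "filled_se M R (R B East) (R B North)"
        unfolding filled_se_def using M(1) facts eq by (intro bexI[of _ A]) auto
      show "\<not> filled_ne M R (R B East) (R B North)"
      proof
        assume "filled_ne M R (R B East) (R B North)"
        then obtain D where D: "D \<in> M" "R D West \<le> R B East" "R B East < R D East"
          "R D South \<le> R B North" "R B North < R D North"
          unfolding filled_ne_def by blast
        have "D \<noteq> A" using D eq by auto
        show False
          using valid_planD(4)[OF V D(1) M(1) \<open>D \<noteq> A\<close>] A'[OF D(1)] D facts eq pos[OF D(1)]
          by linarith
      qed
    qed
  qed
qed

lemma blocked_corner_imp_nontrivial:
  assumes V: "valid_plan M R" and n: "num_concave_corners M R = 1"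
    and M: "A \<in> M" "B \<in> M" "C \<in> M"
    and rel: "right_of R A B" "above R C B"
    and free: "\<And>D. D \<in> M \<Longrightarrow> \<not> above R D A" "\<And>D. D \<in> M \<Longrightarrow> \<not> right_of R D C"
    and AC: "\<not> right_of R A C" "\<not> above R C A"
  shows "\<not> trivial_plan M R"
proof
  assume "trivial_plan M R"
  then obtain R' where st: "(stretch M)\<^sup>*\<^sup>* R R'" and "num_concave_corners M R' < 1"
    unfolding trivial_plan_def n by blast
  then have card0: "card {p. concave_corner (region M R') p} = 0"
    by (simp add: num_concave_corners_def)
  note inv = stretches_preserve[OF st V]
  then have V': "valid_plan M R'" by blast
  have "\<exists>p. concave_corner (region M R') p"
    by (rule blocked_corner_imp_concave[OF V' M]) (use inv M rel free AC in blast)+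
  \<comment> \<open>\<open>card\<close> is 0 for infinite sets as well; finiteness turns the count
    into the absence of concave corners.\<close>
  with card0 finite_concave_corners[OF V'] show False by auto
qed

section \<open>Topology of the region\<close>

text \<open>Choose one point in each interval. The larger one lies in both if they are unbounded
  above, the smaller one if they are unbounded below.\<close>

lemma unbounded_intervals_meet:
  fixes I J :: "real set"
  assumes "is_interval I" "is_interval J"
    and "\<not> bdd_above I \<and> \<not> bdd_above J \<or> \<not> bdd_below I \<and> \<not> bdd_below J"
  shows "I \<inter> J \<noteq> {}"
proof -
  have conv: "c \<in> K" if "is_interval K" "a \<in> K" "b \<in> K" "a \<le> c" "c \<le> b" for K and a b c :: real
    using that unfolding is_interval_1 by blast
  from assms(3) show ?thesis
  proof
    assume ub: "\<not> bdd_above I \<and> \<not> bdd_above J"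
    then obtain x y where xy: "x \<in> I" "y \<in> J" by (metis bdd_above_empty ex_in_conv)
    obtain x' y' where "x' \<in> I" "y' \<in> J" "max x y \<le> x'" "max x y \<le> y'"
      using ub unfolding bdd_above_def by (meson linear)
    with xy have "max x y \<in> I \<inter> J"
      using conv[OF assms(1) xy(1), of x' "max x y"] conv[OF assms(2) xy(2), of y' "max x y"] by auto
    then show ?thesis by blast
  next
    assume lb: "\<not> bdd_below I \<and> \<not> bdd_below J"
    then obtain x y where xy: "x \<in> I" "y \<in> J" by (metis bdd_below_empty ex_in_conv)
    obtain x' y' where "x' \<in> I" "y' \<in> J" "x' \<le> min x y" "y' \<le> min x y"
      using lb unfolding bdd_below_def by (meson linear)
    with xy have "min x y \<in> I \<inter> J"
      using conv[OF assms(1) _ xy(1), of x' "min x y"] conv[OF assms(2) _ xy(2), of y' "min x y"] by auto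
    then show ?thesis by blast
  qed
qed

text \<open>A simple closed curve without one point is a line; the three open arms of a triod would be
  three disjoint closed unbounded intervals on it.\<close>

lemma no_triod_in_loop:
  fixes g :: "real \<Rightarrow> 'a::euclidean_space"
  assumes g: "simple_path g" "pathfinish g = pathstart g"
    and F: "closed_segment z a \<subseteq> path_image g" "closed_segment z b \<subseteq> path_image g"
      "closed_segment z c \<subseteq> path_image g"
    and ne: "a \<noteq> z" "b \<noteq> z" "c \<noteq> z"
    and disj: "closed_segment z a \<inter> closed_segment z b = {z}"
      "closed_segment z a \<inter> closed_segment z c = {z}"
      "closed_segment z b \<inter> closed_segment z c = {z}"
  shows False
proof -
  define F where "F = path_image g"
  have "z \<in> F" using F(1) by (auto simp: F_def)
  have "F homeomorphic sphere (0::complex) 1"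
    unfolding F_def using g by (intro homeomorphic_simple_path_image_circle) auto
  then obtain h k where hk: "homeomorphism F (sphere (0::complex) 1) h k"
    unfolding homeomorphic_def by blast
  have hz: "h z \<in> sphere 0 1"
    using hk \<open>z \<in> F\<close> homeomorphism_image1 by blast
  have "h ` (F - {z}) = sphere 0 1 - {h z}"
  proof -
    have "inj_on h F" using homeomorphism_apply1[OF hk] by (metis inj_onI)
    then have "h ` (F - {z}) = h ` F - h ` {z}"
      by (rule inj_on_image_set_diff) (use \<open>z \<in> F\<close> in auto)
    then show ?thesis using homeomorphism_image1[OF hk] by simp
  qed
  then have "homeomorphism (F - {z}) (sphere 0 1 - {h z}) h k"
    by (intro homeomorphism_of_subsets[OF hk]) auto
  then have "F - {z} homeomorphic (sphere 0 1 - {h z})"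
    unfolding homeomorphic_def by blast
  also have "\<dots> homeomorphic (UNIV :: real set)"
    using hz by (intro homeomorphic_punctured_sphere_affine) auto
  finally obtain h k where hk: "homeomorphism (F - {z}) (UNIV :: real set) h k"
    unfolding homeomorphic_def by blast
  have arm: "is_interval (h ` (closed_segment z d - {z})) \<and>
      (\<not> bdd_above (h ` (closed_segment z d - {z})) \<or> \<not> bdd_below (h ` (closed_segment z d - {z})))"
    if d: "closed_segment z d \<subseteq> F" "d \<noteq> z" for d
  proof -
    let ?K = "closed_segment z d - {z}"
    have KF: "?K \<subseteq> F - {z}" using d by blast
    have Keq: "?K = (\<lambda>t. (1 - t) *\<^sub>R z + t *\<^sub>R d) ` {0<..1}"
    proof (intro set_eqI iffI)
      fix w assume "w \<in> ?K"
      then obtain t where t: "0 \<le> t" "t \<le> 1" "w = (1 - t) *\<^sub>R z + t *\<^sub>R d" "w \<noteq> z"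
        by (auto simp: in_segment)
      then have "t \<noteq> 0" by auto
      with t show "w \<in> (\<lambda>t. (1 - t) *\<^sub>R z + t *\<^sub>R d) ` {0<..1}" by auto
    next
      fix w assume "w \<in> (\<lambda>t. (1 - t) *\<^sub>R z + t *\<^sub>R d) ` {0<..1}"
      then obtain t where t: "0 < t" "t \<le> 1" "w = (1 - t) *\<^sub>R z + t *\<^sub>R d" by auto
      have "w - z = t *\<^sub>R (d - z)" unfolding t(3) by (simp add: algebra_simps)
      then have "w \<noteq> z" using t(1) d(2) by auto
      then show "w \<in> ?K" using t by (auto simp: in_segment intro!: exI[of _ t])
    qed
    have conK: "connected ?K"
      unfolding Keq by (intro connected_continuous_image continuous_intros) auto
    have cont: "continuous_on (F - {z}) h" using hk by (rule homeomorphism_cont1)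
    have int: "is_interval (h ` ?K)"
      unfolding is_interval_connected_1
      by (intro connected_continuous_image continuous_on_subset[OF cont] KF conK)
    \<comment> \<open>The arm is relatively closed in the curve without \<open>z\<close>, so its
      image is closed in the line.\<close>
    have "?K = (F - {z}) \<inter> closed_segment z d" using d by blast
    then have "closedin (top_of_set (F - {z})) ?K"
      by (metis closed_segment closedin_closed_Int)
    then have "closedin (top_of_set UNIV) (h ` ?K)"
      by (rule homeomorphism_imp_closed_map[OF hk])
    then have cl: "closed (h ` ?K)" by simp
    \<comment> \<open>The arm accumulates at the removed point \<open>z\<close>, so it is not
      compact, and neither is its homeomorphic image. A closed subset of the line that is not
      compact is unbounded.\<close>
    have "\<not> compact (h ` ?K)"
    proof
      assume c: "compact (h ` ?K)"
      have "compact (k ` h ` ?K)"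
        by (intro compact_continuous_image c continuous_on_subset[OF homeomorphism_cont2[OF hk]]) auto
      moreover have "k ` h ` ?K = ?K"
        using homeomorphism_apply1[OF hk] KF by (force simp: image_image)
      ultimately have "closed ?K" by (simp add: compact_imp_closed)
      moreover have "z \<in> closure ?K"
      proof -
        have "(\<lambda>n. (1 - inverse (real (Suc n))) *\<^sub>R z + inverse (real (Suc n)) *\<^sub>R d)
            \<longlonglongrightarrow> (1 - 0) *\<^sub>R z + 0 *\<^sub>R d"
          by (intro tendsto_intros LIMSEQ_inverse_real_of_nat)
        moreover have "(1 - inverse (real (Suc n))) *\<^sub>R z + inverse (real (Suc n)) *\<^sub>R d \<in> ?K" for n
          unfolding Keq by (intro imageI) (auto simp: field_simps)
        ultimately show ?thesis
          unfolding closure_sequential by (intro exI conjI) auto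
      qed
      ultimately show False by (simp add: closure_closed)
    qed
    then have "\<not> bounded (h ` ?K)"
      using cl compact_eq_bounded_closed by blast
    moreover have "bounded S" if bd: "bdd_above S" "bdd_below S" for S :: "real set"
    proof -
      obtain l u where "\<forall>x\<in>S. x \<le> u" "\<forall>x\<in>S. l \<le> x"
        using bd unfolding bdd_above_def bdd_below_def by blast
      then have "S \<subseteq> {l..u}" by auto
      then show ?thesis by (meson bounded_closed_interval bounded_subset)
    qed
    ultimately show ?thesis using int by blast
  qed
  have dj: "h ` (closed_segment z d - {z}) \<inter> h ` (closed_segment z e - {z}) = {}"
    if "closed_segment z d \<subseteq> F" "closed_segment z e \<subseteq> F"
      "closed_segment z d \<inter> closed_segment z e = {z}" for d e
  proof -
    have "inj_on h (F - {z})"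
      using homeomorphism_apply1[OF hk] by (metis inj_onI)
    moreover have "(closed_segment z d - {z}) \<inter> (closed_segment z e - {z}) = {}"
      "closed_segment z d - {z} \<subseteq> F - {z}" "closed_segment z e - {z} \<subseteq> F - {z}"
      using that by blast+
    ultimately show ?thesis by (metis inj_on_image_Int image_empty)
  qed
  note F' = F[folded F_def]
  have meet: "\<not> (\<not> bdd_above (h ` (closed_segment z d - {z})) \<and> \<not> bdd_above (h ` (closed_segment z e - {z})))"
    "\<not> (\<not> bdd_below (h ` (closed_segment z d - {z})) \<and> \<not> bdd_below (h ` (closed_segment z e - {z})))"
    if "closed_segment z d \<subseteq> F" "closed_segment z e \<subseteq> F" "d \<noteq> z" "e \<noteq> z"
      "closed_segment z d \<inter> closed_segment z e = {z}" for d e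
    using unbounded_intervals_meet[OF conjunct1[OF arm[OF that(1,3)]] conjunct1[OF arm[OF that(2,4)]]]
      dj[OF that(1,2,5)] by argo+
  \<comment> \<open>Pigeonhole: three disjoint intervals, each unbounded, compete for the two ends
    of the line.\<close>
  show False
    using meet[OF F'(1,2) ne(1,2) disj(1)] meet[OF F'(1,3) ne(1,3) disj(2)]
      meet[OF F'(2,3) ne(2,3) disj(3)] conjunct2[OF arm[OF F'(1) ne(1)]]
      conjunct2[OF arm[OF F'(2) ne(2)]] conjunct2[OF arm[OF F'(3) ne(3)]]
    by argo
qed

text \<open>In a separation of \<open>P\<close> each piece is nonempty and compact, hence has a
  frontier point. Such a point cannot be interior to \<open>P\<close>, since \<open>P\<close> agrees
  with the piece near it. Both pieces thus meet the frontier of \<open>P\<close>, and the separation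
  would split that frontier.\<close>

lemma connected_if_connected_frontier:
  fixes P :: "'a::euclidean_space set"
  assumes "compact P" "connected (frontier P)"
  shows "connected P"
proof (rule ccontr)
  assume "\<not> connected P"
  then obtain A B where AB: "closed A" "closed B" "P \<subseteq> A \<union> B" "A \<inter> B \<inter> P = {}"
    "A \<inter> P \<noteq> {}" "B \<inter> P \<noteq> {}"
    unfolding connected_closed by blast
  have "closed P" using assms(1) by (rule compact_imp_closed)
  then have FP: "frontier P \<subseteq> P" by (rule frontier_subset_closed)
  have meet: "C \<inter> frontier P \<noteq> {}"
    if "closed C" "closed D" "P \<subseteq> C \<union> D" "C \<inter> D \<inter> P = {}" "C \<inter> P \<noteq> {}" for C D
  proof -
    let ?K = "C \<inter> P"
    have clK: "closed ?K" using that(1) \<open>closed P\<close> by (rule closed_Int)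
    have "bounded ?K" using assms(1) by (meson Int_lower2 bounded_subset compact_imp_bounded)
    then have "?K \<noteq> UNIV" using not_bounded_UNIV by metis
    with that(5) have "frontier ?K \<noteq> {}" by (simp add: frontier_eq_empty)
    then obtain x where x: "x \<in> frontier ?K" by blast
    then have xK: "x \<in> ?K" using clK frontier_subset_closed by blast
    have "x \<notin> interior P"
    proof
      assume "x \<in> interior P"
      moreover have "open (interior P - D)" using that(2) by (simp add: open_Diff)
      moreover have "interior P - D \<subseteq> ?K" using that(3) interior_subset by blast
      ultimately have "x \<in> interior ?K"
        using xK that(4) by (metis DiffI IntI disjoint_iff interior_maximal Int_iff subset_iff)
      with x show False by (simp add: frontier_def)
    qed
    then have "x \<in> frontier P" using xK \<open>closed P\<close> by (simp add: frontier_def)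
    with xK show ?thesis by blast
  qed
  have "A \<inter> frontier P \<noteq> {}" using meet[OF AB(1-5)] .
  moreover have "B \<inter> frontier P \<noteq> {}"
    using meet[OF AB(2,1)] AB(3,4,6) by blast
  ultimately show False
    using assms(2) AB(1-4) FP unfolding connected_closed by blast
qed

section \<open>Pinch points of the frontier\<close>

lemma in_interior_pair_iff:
  fixes P :: "(real \<times> real) set"
  shows "(x, y) \<in> interior P \<longleftrightarrow> (\<exists>\<epsilon>>0. \<forall>u v. \<bar>u\<bar> < \<epsilon> \<and> \<bar>v\<bar> < \<epsilon> \<longrightarrow> (x + u, y + v) \<in> P)"
proof
  assume "(x, y) \<in> interior P"
  then obtain T where T: "open T" "(x, y) \<in> T" "T \<subseteq> P" by (auto elim: interiorE)
  then obtain A B where AB: "open A" "open B" "x \<in> A" "y \<in> B" "A \<times> B \<subseteq> T"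
    by (auto elim: open_prod_elim)
  obtain d where d: "d > 0" "\<And>x'. \<bar>x' - x\<bar> < d \<Longrightarrow> x' \<in> A"
    using AB(1,3) unfolding open_real by blast
  obtain d' where d': "d' > 0" "\<And>y'. \<bar>y' - y\<bar> < d' \<Longrightarrow> y' \<in> B"
    using AB(2,4) unfolding open_real by blast
  have "\<forall>u v. \<bar>u\<bar> < min d d' \<and> \<bar>v\<bar> < min d d' \<longrightarrow> (x + u, y + v) \<in> P"
    using d(2)[of "x + _"] d'(2)[of "y + _"] AB(5) T(3) by auto
  then show "\<exists>\<epsilon>>0. \<forall>u v. \<bar>u\<bar> < \<epsilon> \<and> \<bar>v\<bar> < \<epsilon> \<longrightarrow> (x + u, y + v) \<in> P"
    using d(1) d'(1) by (intro exI[of _ "min d d'"]) auto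
next
  assume "\<exists>\<epsilon>>0. \<forall>u v. \<bar>u\<bar> < \<epsilon> \<and> \<bar>v\<bar> < \<epsilon> \<longrightarrow> (x + u, y + v) \<in> P"
  then obtain e where e: "e > 0" "\<And>u v. \<bar>u\<bar> < e \<Longrightarrow> \<bar>v\<bar> < e \<Longrightarrow> (x + u, y + v) \<in> P" by blast
  have "{x - e<..<x + e} \<times> {y - e<..<y + e} \<subseteq> P"
  proof (clarify)
    fix x' y' assume "x' \<in> {x - e<..<x + e}" "y' \<in> {y - e<..<y + e}"
    then show "(x', y') \<in> P" using e(2)[of "x' - x" "y' - y"] by auto
  qed
  then show "(x, y) \<in> interior P"
    by (rule interiorI[rotated 2]) (auto intro: open_Times simp: e(1))
qed

lemma in_frontier_pairI:
  fixes P :: "(real \<times> real) set"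
  assumes "(x, y) \<in> P" "\<And>\<epsilon>. \<epsilon> > 0 \<Longrightarrow> \<exists>u v. \<bar>u\<bar> < \<epsilon> \<and> \<bar>v\<bar> < \<epsilon> \<and> (x + u, y + v) \<notin> P"
  shows "(x, y) \<in> frontier P"
proof -
  have "(x, y) \<notin> interior P" unfolding in_interior_pair_iff using assms(2) by meson
  moreover have "(x, y) \<in> closure P" using assms(1) closure_subset by blast
  ultimately show ?thesis by (simp add: frontier_def)
qed

lemma compact_region: "finite M \<Longrightarrow> compact (region M R)"
  unfolding region_def rect_set_def by (intro compact_UN compact_Times) auto

text \<open>If exactly two diagonally opposite quadrants are filled, all four half-axes near the
  point belong to the frontier. Three of them form a triod, which a simple closed curve does not
  contain.\<close>

lemma no_pinch:
  assumes fp: "floor_plan M R"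
  shows "\<not> (filled_ne M R x y \<and> filled_sw M R x y \<and> \<not> filled_nw M R x y \<and> \<not> filled_se M R x y)"
    "\<not> (filled_nw M R x y \<and> filled_se M R x y \<and> \<not> filled_ne M R x y \<and> \<not> filled_sw M R x y)"
proof -
  from fp obtain g where V: "valid_plan M R" and g: "simple_path g" "pathfinish g = pathstart g"
    "path_image g = frontier (region M R)"
    unfolding floor_plan_iff by blast
  obtain \<epsilon> where e: "\<epsilon> > 0" "\<And>u v. \<bar>u\<bar> < \<epsilon> \<Longrightarrow> \<bar>v\<bar> < \<epsilon> \<Longrightarrow> (x + u, y + v) \<in> region M R \<longleftrightarrow>
      u \<ge> 0 \<and> v \<ge> 0 \<and> filled_ne M R x y \<or> u \<le> 0 \<and> v \<ge> 0 \<and> filled_nw M R x y \<or>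
      u \<ge> 0 \<and> v \<le> 0 \<and> filled_se M R x y \<or> u \<le> 0 \<and> v \<le> 0 \<and> filled_sw M R x y"
    using region_local[OF V] by blast
  define h where "h = \<epsilon> / 2"
  have h: "h > 0" "h < \<epsilon>" using e(1) by (auto simp: h_def)
  \<comment> \<open>\<open>(s, s')\<close> is a diagonal direction into an empty quadrant. The bound
    \<open>\<epsilon> - h\<close> keeps the displaced point inside the square where the quadrant
    description holds.\<close>
  have fr: "(x + a, y + b) \<in> frontier (region M R)"
    if ab: "\<bar>a\<bar> \<le> h" "\<bar>b\<bar> \<le> h" "(x + a, y + b) \<in> region M R"
      and s: "\<And>\<eta>. 0 < \<eta> \<Longrightarrow> \<eta> < \<epsilon> - h \<Longrightarrow> (x + (a + s * \<eta>), y + (b + s' * \<eta>)) \<notin> region M R"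
      and s': "\<bar>s\<bar> = 1" "\<bar>s'\<bar> = 1" for a b s s'
  proof (rule in_frontier_pairI)
    fix \<epsilon>' :: real assume "\<epsilon>' > 0"
    define \<eta> where "\<eta> = min \<epsilon>' (\<epsilon> - h) / 2"
    have \<eta>: "\<eta> > 0" "\<eta> < \<epsilon>'" "\<eta> < \<epsilon> - h"
      using \<open>\<epsilon>' > 0\<close> h by (auto simp: \<eta>_def min_def)
    show "\<exists>u v. \<bar>u\<bar> < \<epsilon>' \<and> \<bar>v\<bar> < \<epsilon>' \<and> (x + a + u, y + b + v) \<notin> region M R"
      using s[OF \<eta>(1,3)] s' \<eta>
      by (intro exI[of _ "s * \<eta>"] exI[of _ "s' * \<eta>"]) (auto simp: abs_mult add.assoc)
  qed (rule ab(3))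
  have triod: False
    if "\<And>t. 0 \<le> t \<Longrightarrow> t \<le> h \<Longrightarrow> (x + t, y) \<in> frontier (region M R)"
      "\<And>t. 0 \<le> t \<Longrightarrow> t \<le> h \<Longrightarrow> (x, y + t) \<in> frontier (region M R)"
      "\<And>t. 0 \<le> t \<Longrightarrow> t \<le> h \<Longrightarrow> (x - t, y) \<in> frontier (region M R)"
  proof (rule no_triod_in_loop[OF g(1,2), of "(x, y)" "(x + h, y)" "(x, y + h)" "(x - h, y)"])
    show "closed_segment (x, y) (x + h, y) \<subseteq> path_image g"
      using that(1)[of "_ - x"] h(1)
      by (auto simp: g(3) closed_segment_horizontal closed_segment_eq_real_ivl)
    show "closed_segment (x, y) (x, y + h) \<subseteq> path_image g"
      using that(2)[of "_ - y"] h(1)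
      by (auto simp: g(3) closed_segment_vertical closed_segment_eq_real_ivl)
    show "closed_segment (x, y) (x - h, y) \<subseteq> path_image g"
      using that(3)[of "x - _"] h(1)
      by (auto simp: g(3) closed_segment_horizontal closed_segment_eq_real_ivl)
  qed (use h(1) in \<open>auto simp: closed_segment_horizontal closed_segment_vertical closed_segment_eq_real_ivl\<close>)
  show "\<not> (filled_ne M R x y \<and> filled_sw M R x y \<and> \<not> filled_nw M R x y \<and> \<not> filled_se M R x y)"
  proof
    assume f: "filled_ne M R x y \<and> filled_sw M R x y \<and> \<not> filled_nw M R x y \<and> \<not> filled_se M R x y"
    show False
    proof (rule triod)
      fix t assume t: "0 \<le> t" "t \<le> h"
      show "(x + t, y) \<in> frontier (region M R)"
        using fr[of t 0 1 "-1"] e(2)[of t 0] e(2)[of "t + _" "- _"] f t h by auto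
      show "(x, y + t) \<in> frontier (region M R)"
        using fr[of 0 t "-1" 1] e(2)[of 0 t] e(2)[of "- _" "t + _"] f t h by auto
      show "(x - t, y) \<in> frontier (region M R)"
        using fr[of "-t" 0 "-1" 1] e(2)[of "-t" 0] e(2)[of "-t + - _" "_"] f t h by auto
    qed
  qed
  show "\<not> (filled_nw M R x y \<and> filled_se M R x y \<and> \<not> filled_ne M R x y \<and> \<not> filled_sw M R x y)"
  proof
    assume f: "filled_nw M R x y \<and> filled_se M R x y \<and> \<not> filled_ne M R x y \<and> \<not> filled_sw M R x y"
    show False
    proof (rule triod)
      fix t assume t: "0 \<le> t" "t \<le> h"
      show "(x + t, y) \<in> frontier (region M R)"
        using fr[of t 0 1 1] e(2)[of t 0] e(2)[of "t + _" "_"] f t h by auto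
      show "(x, y + t) \<in> frontier (region M R)"
        using fr[of 0 t 1 1] e(2)[of 0 t] e(2)[of "_" "t + _"] f t h by auto
      show "(x - t, y) \<in> frontier (region M R)"
        using fr[of "-t" 0 "-1" "-1"] e(2)[of "-t" 0] e(2)[of "-t + - _" "- _"] f t h by auto
    qed
  qed
qed

section \<open>A region with one concave corner is an L\<close>

text \<open>A grid indexed by all integers has no first or last line, so the neighbours
  \<open>i - 1\<close> and \<open>i + 1\<close> always exist and border cases do not arise. A new
  point is inserted by shifting the indices behind it.\<close>

lemma grid_through_finite_set:
  assumes "finite (X :: real set)"
  shows "\<exists>g :: int \<Rightarrow> real. strict_mono g \<and> X \<subseteq> range g \<and> (\<forall>x. \<exists>k. g k \<le> x \<and> x < g (k + 1))"
  using assms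
proof induction
  case empty
  have "\<exists>k. real_of_int k \<le> x \<and> x < real_of_int (k + 1)" for x
    by (intro exI[of _ "\<lfloor>x\<rfloor>"]) simp
  then show ?case by (intro exI[of _ real_of_int]) (simp add: strict_mono_def)
next
  case (insert z X)
  then obtain g :: "int \<Rightarrow> real" where g: "strict_mono g" "X \<subseteq> range g" "\<And>x. \<exists>k. g k \<le> x \<and> x < g (k + 1)"
    by blast
  show ?case
  proof (cases "z \<in> range g")
    case True
    with g show ?thesis by blast
  next
    case False
    obtain n where n: "g n \<le> z" "z < g (n + 1)" using g(3) by blast
    with False have n': "g n < z" by (metis order_le_less rangeI)
    define g' where "g' i = (if i \<le> n then g i else if i = n + 1 then z else g (i - 1))" for i
    have gm: "i < j \<Longrightarrow> g i < g j" "i \<le> j \<Longrightarrow> g i \<le> g j" for i j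
      using g(1) by (auto simp: strict_mono_less strict_mono_less_eq)
    have step: "g' i < g' (i + 1)" for i
      unfolding g'_def using n n' gm(1)[of i "i + 1"] gm(1)[of "i - 1" i] by auto
    have "strict_mono g'"
    proof (rule strict_monoI)
      fix i j :: int assume "i < j"
      then show "g' i < g' j"
        by (induction rule: int_gr_induct) (use step less_trans in blast)+
    qed
    moreover have "insert z X \<subseteq> range g'"
    proof -
      have "g k \<in> range g'" for k
      proof (cases "k \<le> n")
        case True
        then have "g k = g' k" by (simp add: g'_def)
        then show ?thesis by blast
      next
        case False
        then have "g k = g' (k + 1)" by (simp add: g'_def)
        then show ?thesis by blast
      qed
      moreover have "z = g' (n + 1)" by (simp add: g'_def)
      ultimately show ?thesis using g(2) by blast
    qed
    moreover have "\<exists>k. g' k \<le> x \<and> x < g' (k + 1)" for x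
    proof -
      obtain k where k: "g k \<le> x" "x < g (k + 1)" using g(3) by blast
      consider "k < n" | "k = n" "x < z" | "k = n" "z \<le> x" | "k > n" by linarith
      then show ?thesis
      proof cases
        case 1 with k show ?thesis by (intro exI[of _ k]) (auto simp: g'_def)
      next
        case 2 with k show ?thesis by (intro exI[of _ k]) (auto simp: g'_def)
      next
        case 3 with k show ?thesis by (intro exI[of _ "k + 1"]) (auto simp: g'_def add.commute)
      next
        case 4 with k show ?thesis by (intro exI[of _ "k + 1"]) (auto simp: g'_def add.commute)
      qed
    qed
    ultimately show ?thesis by blast
  qed
qed

lemma int_run_end:
  fixes k0 k1 :: int
  assumes "Q k0" "k0 < k1" "\<not> Q k1"
  obtains r where "k0 < r" "\<And>k. k0 \<le> k \<Longrightarrow> k < r \<Longrightarrow> Q k" "\<not> Q r"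
proof -
  define n where "n = (LEAST n. \<not> Q (k0 + int n))"
  have "\<not> Q (k0 + int (nat (k1 - k0)))" using assms by simp
  then have n: "\<not> Q (k0 + int n)" unfolding n_def by (rule LeastI)
  have l: "Q (k0 + int m)" if "m < n" for m using not_less_Least[of m] that unfolding n_def by blast
  show thesis
  proof (rule that[of "k0 + int n"])
    show "k0 < k0 + int n" using n assms(1) by (cases n) auto
    show "Q k" if "k0 \<le> k" "k < k0 + int n" for k
      using l[of "nat (k - k0)"] that by auto
  qed (rule n)
qed

lemma int_run_start:
  fixes k0 k1 :: int
  assumes "Q k0" "k1 < k0" "\<not> Q k1"
  obtains l where "l < k0" "\<And>k. l < k \<Longrightarrow> k \<le> k0 \<Longrightarrow> Q k" "\<not> Q l"
proof -
  obtain r where r: "- k0 < r" "\<And>k. - k0 \<le> k \<Longrightarrow> k < r \<Longrightarrow> Q (- k)" "\<not> Q (- r)"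
    using int_run_end[of "\<lambda>k. Q (- k)" "- k0" "- k1"] assms by auto
  have "Q k" if "- r < k" "k \<le> k0" for k using r(2)[of "- k"] that by auto
  with r show thesis by (intro that[of "- r"]) auto
qed

text \<open>The rows \<open>p\<close> and \<open>q\<close> are neighbouring; \<open>loc\<close> says that at each vertex between them two
  diagonally opposite cells occur only together with the other two.\<close>

lemma next_row:
  fixes l r :: int
  assumes p: "\<And>i. l - 1 \<le> i \<Longrightarrow> i \<le> r \<Longrightarrow> p i \<longleftrightarrow> l \<le> i \<and> i < r"
    and loc: "\<And>i. l \<le> i \<Longrightarrow> i \<le> r \<Longrightarrow> q i \<Longrightarrow> p (i - 1) \<Longrightarrow> q (i - 1) \<and> p i"
      "\<And>i. l \<le> i \<Longrightarrow> i \<le> r \<Longrightarrow> q (i - 1) \<Longrightarrow> p i \<Longrightarrow> q i \<and> p (i - 1)"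
    and "l < r"
    and k: "l - 1 \<le> k" "k \<le> r" "q k"
    and i: "l - 1 \<le> i" "i \<le> r"
  shows "q i \<longleftrightarrow> l \<le> i \<and> i < r"
proof -
  have out: "\<not> q (l - 1)" "\<not> q r"
    using loc(2)[of l] loc(1)[of r] p[of l] p[of "l - 1"] p[of r] p[of "r - 1"] \<open>l < r\<close> by auto
  then have k': "l \<le> k" "k < r" using k by (smt (verit))+
  have up: "i < r \<longrightarrow> q i" if "k \<le> i" for i
    using that
  proof (induction i rule: int_ge_induct)
    case (step i)
    then show ?case using loc(2)[of "i + 1"] p[of "i + 1"] k' by auto
  qed (use k in simp)
  have down: "l \<le> i \<longrightarrow> q i" if "i \<le> k" for i
    using that
  proof (induction i rule: int_le_induct)
    case (step i)
    then show ?case using loc(1)[of i] p[of "i - 1"] k' by auto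
  qed (use k in simp)
  show ?thesis
    using up[of i] down[of i] out i by (smt (verit))
qed

text \<open>\<open>S i j\<close> stands for the cell with south-west vertex \<open>(i, j)\<close>;
  the other cells at this vertex are \<open>S (i - 1) j\<close>, \<open>S i (j - 1)\<close> and
  \<open>S (i - 1) (j - 1)\<close>. The concave corner is the vertex \<open>(a, b)\<close>. The
  conclusion also lists the empty cells bordering the L, because they isolate it from the
  rest.\<close>

lemma L_shape_of_cells:
  fixes S :: "int \<Rightarrow> int \<Rightarrow> bool"
  assumes loc1: "\<And>i j. (i, j) \<noteq> (a, b) \<Longrightarrow> S i j \<Longrightarrow> S (i - 1) (j - 1) \<Longrightarrow> S (i - 1) j \<and> S i (j - 1)"
    and loc2: "\<And>i j. (i, j) \<noteq> (a, b) \<Longrightarrow> S (i - 1) j \<Longrightarrow> S i (j - 1) \<Longrightarrow> S i j \<and> S (i - 1) (j - 1)"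
    and corner: "S (a - 1) b" "S a (b - 1)" "S (a - 1) (b - 1)" "\<not> S a b"
    and fin: "\<And>i j. n \<le> \<bar>i\<bar> \<or> n \<le> \<bar>j\<bar> \<Longrightarrow> \<not> S i j"
  shows "\<exists>l r s t. l < a \<and> a < r \<and> s < b \<and> b < t \<and>
    (\<forall>i j. s \<le> j \<and> j < b \<and> l - 1 \<le> i \<and> i \<le> r \<longrightarrow> (S i j \<longleftrightarrow> l \<le> i \<and> i < r)) \<and>
    (\<forall>i. l - 1 \<le> i \<and> i \<le> r \<longrightarrow> \<not> S i (s - 1)) \<and>
    (\<forall>i j. b \<le> j \<and> j < t \<and> l - 1 \<le> i \<and> i \<le> a \<longrightarrow> (S i j \<longleftrightarrow> l \<le> i \<and> i < a)) \<and>
    (\<forall>i. l - 1 \<le> i \<and> i \<le> a \<longrightarrow> \<not> S i t) \<and>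
    (\<forall>i. a \<le> i \<and> i \<le> r \<longrightarrow> \<not> S i b)"
proof -
  have far1: "\<exists>k>c. \<forall>i j. k \<le> i \<or> k \<le> j \<longrightarrow> \<not> S i j" for c
  proof -
    have "n \<le> \<bar>i\<bar> \<or> n \<le> \<bar>j\<bar>" if "max (c + 1) n \<le> i \<or> max (c + 1) n \<le> j" for i j
      using that by linarith
    then show ?thesis using fin by (intro exI[of _ "max (c + 1) n"] conjI allI impI) auto
  qed
  have far2: "\<exists>k<c. \<forall>i j. i \<le> k \<or> j \<le> k \<longrightarrow> \<not> S i j" for c
  proof -
    have "n \<le> \<bar>i\<bar> \<or> n \<le> \<bar>j\<bar>" if "i \<le> min (c - 1) (- n) \<or> j \<le> min (c - 1) (- n)" for i j
      using that by linarith
    then show ?thesis using fin by (intro exI[of _ "min (c - 1) (- n)"] conjI allI impI) auto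
  qed
  obtain r where r: "a < r" "\<And>i. a \<le> i \<Longrightarrow> i < r \<Longrightarrow> S i (b - 1)" "\<not> S r (b - 1)"
    using int_run_end[of "\<lambda>i. S i (b - 1)" a] corner(2) far1[of a] by (metis order_refl)
  obtain l' where l': "l' < a - 1" "\<And>i. l' < i \<Longrightarrow> i \<le> a - 1 \<Longrightarrow> S i (b - 1)" "\<not> S l' (b - 1)"
    using int_run_start[of "\<lambda>i. S i (b - 1)" "a - 1"] corner(3) far2[of "a - 1"] by (metis order_refl)
  define l where "l = l' + 1"
  have l: "l < a" using l' by (simp add: l_def)
  have below: "S i (b - 1) \<longleftrightarrow> l \<le> i \<and> i < r" if "l - 1 \<le> i" "i \<le> r" for i
  proof (cases "i < a")
    case True
    then show ?thesis using l'(2)[of i] l'(3) that r(1) by (cases "i = l'") (auto simp: l_def)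
  next
    case False
    then show ?thesis using r(2)[of i] r(3) that l by (cases "i = r") auto
  qed
  \<comment> \<open>A filled cell \<open>(i + 1, b)\<close> together with the filled cell
    \<open>(i, b - 1)\<close> would force \<open>(i, b)\<close>, which is empty by
    induction.\<close>
  have right: "\<not> S i b" if "a \<le> i" "i \<le> r" for i
    using that
  proof (induction i rule: int_ge_induct)
    case (step i)
    then show ?case using loc1[of "i + 1" b] below[of i] l by auto
  qed (rule corner(4))
  \<comment> \<open>Row \<open>b\<close> inherits its left end from row \<open>b - 1\<close>: going
    left from \<open>(a - 1, b)\<close>, each filled cell and the filled cell diagonally below it
    force the next one. Beyond \<open>l\<close> a filled cell would force
    \<open>(l - 1, b - 1)\<close>.\<close>
  have left: "S i b \<longleftrightarrow> l \<le> i \<and> i < a" if "l - 1 \<le> i" "i \<le> a" for i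
  proof -
    have "l \<le> i \<longrightarrow> S i b" if "i \<le> a - 1" for i
      using that
    proof (induction i rule: int_le_induct)
      case (step i)
      then show ?case using loc1[of i b] below[of "i - 1"] r(1) by auto
    qed (simp add: corner(1))
    moreover have "\<not> S (l - 1) b"
      using loc2[of l b] below[of l] below[of "l - 1"] l r(1) by auto
    ultimately show ?thesis using that corner(4) by (smt (verit))
  qed
  define up where "up j \<longleftrightarrow> (\<forall>i. l - 1 \<le> i \<and> i \<le> a \<longrightarrow> (S i j \<longleftrightarrow> l \<le> i \<and> i < a))" for j
  define down where "down j \<longleftrightarrow> (\<forall>i. l - 1 \<le> i \<and> i \<le> r \<longrightarrow> (S i j \<longleftrightarrow> l \<le> i \<and> i < r))" for j
  have upb: "up b" using left by (auto simp: up_def)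
  have downb: "down (b - 1)" using below by (auto simp: down_def)
  obtain k1 where k1: "b < k1" "\<not> S l k1" using far1[of b] by blast
  then have "\<not> up k1" using l unfolding up_def by (intro notI) (drule spec[of _ l]; simp)
  then obtain t where t: "b < t" "\<And>j. b \<le> j \<Longrightarrow> j < t \<Longrightarrow> up j" "\<not> up t"
    using int_run_end[of up b k1] upb k1 by blast
  obtain k2 where k2: "k2 < b - 1" "\<not> S l k2" using far2[of "b - 1"] by blast
  then have "\<not> down k2" using l r(1) unfolding down_def by (intro notI) (drule spec[of _ l]; simp)
  then obtain s' where s': "s' < b - 1" "\<And>j. s' < j \<Longrightarrow> j \<le> b - 1 \<Longrightarrow> down j" "\<not> down s'"
    using int_run_start[of down "b - 1" k2] downb k2 by blast
  \<comment> \<open>The first row breaking the pattern is empty along the L: by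
    \<open>next_row\<close> a single filled cell would already produce the whole pattern.\<close>
  have top: "\<not> S k t" if k: "l - 1 \<le> k" "k \<le> a" for k
  proof
    assume "S k t"
    have "up (t - 1)" using t by auto
    have "S i t \<longleftrightarrow> l \<le> i \<and> i < a" if "l - 1 \<le> i" "i \<le> a" for i
    proof (rule next_row[of l a "\<lambda>i. S i (t - 1)" "\<lambda>i. S i t" k i])
      show "S i (t - 1) \<longleftrightarrow> l \<le> i \<and> i < a" if "l - 1 \<le> i" "i \<le> a" for i
        using \<open>up (t - 1)\<close> that unfolding up_def by blast
      have ne: "(i, t) \<noteq> (a, b)" for i using t(1) by auto
      show "S (i - 1) t \<and> S i (t - 1)" if "S i t" "S (i - 1) (t - 1)" for i
        by (rule loc1[OF ne that])
      show "S i t \<and> S (i - 1) (t - 1)" if "S (i - 1) t" "S i (t - 1)" for i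
        by (rule loc2[OF ne that])
    qed (rule l k \<open>S k t\<close> that)+
    then show False using t(3) by (simp add: up_def)
  qed
  have bottom: "\<not> S k s'" if k: "l - 1 \<le> k" "k \<le> r" for k
  proof
    assume "S k s'"
    have "down (s' + 1)" using s' by auto
    have "S i s' \<longleftrightarrow> l \<le> i \<and> i < r" if "l - 1 \<le> i" "i \<le> r" for i
    proof (rule next_row[of l r "\<lambda>i. S i (s' + 1)" "\<lambda>i. S i s'" k i])
      show "S i (s' + 1) \<longleftrightarrow> l \<le> i \<and> i < r" if "l - 1 \<le> i" "i \<le> r" for i
        using \<open>down (s' + 1)\<close> that unfolding down_def by blast
      have ne: "(i, s' + 1) \<noteq> (a, b)" for i using s'(1) by auto
      \<comment> \<open>The known row now lies above the new one, so the two diagonals at a vertex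
        exchange roles, and with them \<open>loc1\<close> and \<open>loc2\<close>.\<close>
      show "S (i - 1) s' \<and> S i (s' + 1)" if "S i s'" "S (i - 1) (s' + 1)" for i
        using loc2[OF ne, of i] that by simp
      show "S i s' \<and> S (i - 1) (s' + 1)" if "S (i - 1) s'" "S i (s' + 1)" for i
        using loc1[OF ne, of i] that by simp
      show "l < r" using l r(1) by simp
    qed (rule k \<open>S k s'\<close> that)+
    then show False using s'(3) by (simp add: down_def)
  qed
  have "S i j \<longleftrightarrow> l \<le> i \<and> i < r" if "s' + 1 \<le> j" "j < b" "l - 1 \<le> i" "i \<le> r" for i j
    using s'(2)[of j] that unfolding down_def by auto
  moreover have "S i j \<longleftrightarrow> l \<le> i \<and> i < a" if "b \<le> j" "j < t" "l - 1 \<le> i" "i \<le> a" for i j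
    using t(2)[of j] that unfolding up_def by auto
  moreover have "\<not> S i (s' + 1 - 1)" if "l - 1 \<le> i" "i \<le> r" for i
    using bottom[OF that] by simp
  moreover have "s' + 1 < b" using s'(1) by simp
  ultimately show ?thesis
    using l r(1) t(1) top right by blast
qed

section \<open>From grid cells to the region\<close>

lemma connected_subset_clopen:
  assumes "connected P" "closed Q" "open U" "Q \<subseteq> U" "U \<inter> P \<subseteq> Q" "Q \<inter> P \<noteq> {}"
  shows "P \<subseteq> Q"
proof (rule ccontr)
  assume "\<not> P \<subseteq> Q"
  then have "- U \<inter> P \<noteq> {}" using assms(5) by blast
  moreover have "closed (- U)" using assms(3) by (simp add: closed_Compl)
  moreover have "P \<subseteq> Q \<union> - U" "Q \<inter> - U \<inter> P = {}" using assms(4,5) by blast+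
  ultimately show False using assms(1,2,6) unfolding connected_closed by blast
qed

text \<open>On each axis the parameters are meant in increasing order. The concave corner is
  \<open>(px, py)\<close>, and the notch lies beyond \<open>px\<close> and
  \<open>py\<close>.\<close>

definition L_region :: "real \<Rightarrow> real \<Rightarrow> real \<Rightarrow> real \<Rightarrow> real \<Rightarrow> real \<Rightarrow> (real \<times> real) set" where
  "L_region x0 px x1 y0 py y1 = {x0..x1} \<times> {y0..py} \<union> {x0..px} \<times> {y0..y1}"

lemma grid_interval_cell:
  fixes g :: "int \<Rightarrow> real"
  assumes g: "strict_mono g" "\<And>x. \<exists>k. g k \<le> x \<and> x < g (k + 1)"
    and "c \<in> range g" "d \<in> range g" "c < d" "c \<le> x" "x \<le> d"
  shows "\<exists>k. c \<le> g k \<and> g k < d \<and> g k \<le> x \<and> x \<le> g (k + 1)"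
proof -
  obtain a b where ab: "c = g a" "d = g b" using assms(3,4) by blast
  note mono = strict_mono_less[OF g(1)] strict_mono_less_eq[OF g(1)]
  show ?thesis
  proof (cases "x = d")
    \<comment> \<open>The half-open cell containing \<open>d\<close> lies outside the interval, so
      the right end is assigned to the cell before it.\<close>
    case True
    have "a < b" using assms(5) by (simp add: ab mono)
    then show ?thesis using True by (intro exI[of _ "b - 1"]) (simp add: ab mono)
  next
    case False
    obtain k where k: "g k \<le> x" "x < g (k + 1)" using g(2) by blast
    have "g a < g (k + 1)" "g k < g b" using k False assms(6,7) ab by linarith+
    then show ?thesis using k by (intro exI[of _ k]) (simp add: ab mono)
  qed
qed

lemma unique_concave_corner_L_region:
  assumes fp: "floor_plan M R" and p: "concave_towards 1 1 (region M R) (px, py)"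
    and unique: "\<And>q. concave_corner (region M R) q \<Longrightarrow> q = (px, py)"
  obtains x0 x1 y0 y1 where "x0 < px" "px < x1" "y0 < py" "py < y1"
    "region M R = L_region x0 px x1 y0 py y1"
proof -
  obtain g where V: "valid_plan M R" and g: "simple_path g" "path_image g = frontier (region M R)"
    using fp unfolding floor_plan_iff by blast
  have "finite M" using valid_planD(1)[OF V] .
  have "concave_corner (region M R) (px, py)"
    using p unfolding concave_corner_iff by blast
  \<comment> \<open>This places the corner on the grid.\<close>
  note pcoord = concave_corner_coordinates[OF V this]
  let ?X = "\<Union>i\<in>M. {R i West, R i East}" and ?Y = "\<Union>i\<in>M. {R i South, R i North}"
  obtain gx :: "int \<Rightarrow> real" where gx: "strict_mono gx" "?X \<subseteq> range gx"
      "\<And>x. \<exists>k. gx k \<le> x \<and> x < gx (k + 1)"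
    using grid_through_finite_set[of ?X] \<open>finite M\<close> by auto
  obtain gy :: "int \<Rightarrow> real" where gy: "strict_mono gy" "?Y \<subseteq> range gy"
      "\<And>x. \<exists>k. gy k \<le> x \<and> x < gy (k + 1)"
    using grid_through_finite_set[of ?Y] \<open>finite M\<close> by auto
  obtain a where a: "px = gx a" using pcoord(1) gx(2) by blast
  obtain b where b: "py = gy b" using pcoord(2) gy(2) by blast
  note mx = strict_mono_less[OF gx(1)] strict_mono_less_eq[OF gx(1)]
  note my = strict_mono_less[OF gy(1)] strict_mono_less_eq[OF gy(1)]
  \<comment> \<open>No grid line lies strictly between \<open>h (i - 1)\<close> and
    \<open>h i\<close>. For \<open>c\<close> on a grid line a strict comparison with one is
    therefore a weak comparison with the other.\<close>
  have shift: "c < h i \<longleftrightarrow> c \<le> h (i - 1)" "h i \<le> c \<longleftrightarrow> h (i - 1) < c"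
    if "strict_mono h" "c \<in> range h" for h :: "int \<Rightarrow> real" and c i
    using that by (auto simp: strict_mono_less strict_mono_less_eq)
  have rng: "R m West \<in> range gx" "R m East \<in> range gx" "R m South \<in> range gy" "R m North \<in> range gy"
    if "m \<in> M" for m using that gx(2) gy(2) by auto
  \<comment> \<open>A cell is represented by the north-east quadrant at its south-west vertex; the
    other three quadrants at a vertex belong to neighbouring cells.\<close>
  define S where "S i j = filled_ne M R (gx i) (gy j)" for i j
  have nw: "filled_nw M R (gx i) (gy j) = S (i - 1) j" for i j
    unfolding S_def filled_nw_def filled_ne_def
    using shift[OF gx(1), of _ i] rng by (metis (no_types, lifting))
  have se: "filled_se M R (gx i) (gy j) = S i (j - 1)" for i j
    unfolding S_def filled_se_def filled_ne_def
    using shift[OF gy(1), of _ j] rng by (metis (no_types, lifting))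
  have sw: "filled_sw M R (gx i) (gy j) = S (i - 1) (j - 1)" for i j
    unfolding S_def filled_sw_def filled_ne_def
    using shift[OF gy(1), of _ j] shift[OF gx(1), of _ i] rng by (metis (no_types, lifting))
  note q = S_def[symmetric] nw se sw
  have reg: "(x, y) \<in> region M R \<longleftrightarrow>
      (\<exists>i j. S i j \<and> gx i \<le> x \<and> x \<le> gx (i + 1) \<and> gy j \<le> y \<and> y \<le> gy (j + 1))" for x y
  proof
    assume "(x, y) \<in> region M R"
    then obtain m where m: "m \<in> M" "R m West \<le> x" "x \<le> R m East" "R m South \<le> y" "y \<le> R m North"
      unfolding mem_region by blast
    obtain i where i: "R m West \<le> gx i" "gx i < R m East" "gx i \<le> x" "x \<le> gx (i + 1)"
      using grid_interval_cell[OF gx(1,3) rng(1,2)[OF m(1)] valid_planD(2)[OF V m(1)] m(2,3)] by blast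
    obtain j where j: "R m South \<le> gy j" "gy j < R m North" "gy j \<le> y" "y \<le> gy (j + 1)"
      using grid_interval_cell[OF gy(1,3) rng(3,4)[OF m(1)] valid_planD(3)[OF V m(1)] m(4,5)] by blast
    show "\<exists>i j. S i j \<and> gx i \<le> x \<and> x \<le> gx (i + 1) \<and> gy j \<le> y \<and> y \<le> gy (j + 1)"
      using i j m(1) unfolding S_def filled_ne_def by blast
  next
    assume "\<exists>i j. S i j \<and> gx i \<le> x \<and> x \<le> gx (i + 1) \<and> gy j \<le> y \<and> y \<le> gy (j + 1)"
    then obtain i j m where ij: "gx i \<le> x" "x \<le> gx (i + 1)" "gy j \<le> y" "y \<le> gy (j + 1)"
      and m: "m \<in> M" "R m West \<le> gx i" "gx i < R m East" "R m South \<le> gy j" "gy j < R m North"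
      unfolding S_def filled_ne_def by blast
    have "gx (i + 1) \<le> R m East" "gy (j + 1) \<le> R m North"
      using shift(2)[OF gx(1) rng(2)[OF m(1)], of "i + 1"] shift(2)[OF gy(1) rng(4)[OF m(1)], of "j + 1"] m
      by auto
    with ij m show "(x, y) \<in> region M R" unfolding mem_region by force
  qed
  have vertex: "(gx i, gy j) = (px, py) \<longleftrightarrow> (i, j) = (a, b)" for i j
    using gx(1) gy(1) by (simp add: a b strict_mono_eq)
  \<comment> \<open>Two diagonally opposite filled cells with both others empty form a pinch. With
    exactly one other empty they form a concave corner, which occurs only at
    \<open>(px, py)\<close>.\<close>
  have loc: "S i j \<Longrightarrow> S (i - 1) (j - 1) \<Longrightarrow> S (i - 1) j \<and> S i (j - 1)"
    "S (i - 1) j \<Longrightarrow> S i (j - 1) \<Longrightarrow> S i j \<and> S (i - 1) (j - 1)" if "(i, j) \<noteq> (a, b)" for i j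
    using no_pinch[OF fp, of "gx i" "gy j"] three_filled_imp_concave[OF V, of "gx i" "gy j"]
      unique[of "(gx i, gy j)"] that unfolding q vertex by blast+
  have corner: "S (a - 1) b" "S a (b - 1)" "S (a - 1) (b - 1)" "\<not> S a b"
    using concave_ne_filled[OF V p] unfolding a b q by blast+
  obtain n where n: "\<And>i j. n \<le> \<bar>i\<bar> \<or> n \<le> \<bar>j\<bar> \<Longrightarrow> \<not> S i j"
  proof -
    have bd: "\<exists>N. \<forall>i. N \<le> \<bar>i\<bar> \<longrightarrow> \<not> (\<exists>m\<in>M. lo m \<le> h i \<and> h i < hi m)"
      if h: "strict_mono h" "\<And>x. \<exists>k. h k \<le> x \<and> x < h (k + 1)"
      for h :: "int \<Rightarrow> real" and lo hi :: "'a \<Rightarrow> real"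
    proof -
      have "\<exists>N. \<forall>i. N \<le> \<bar>i\<bar> \<longrightarrow> \<not> (lo m \<le> h i \<and> h i < hi m)" for m
      proof -
        obtain k where k: "h k \<le> lo m" using h(2) by blast
        obtain k' where k': "hi m < h (k' + 1)" using h(2) by blast
        have "\<not> (lo m \<le> h i \<and> h i < hi m)" if "\<bar>k\<bar> + \<bar>k'\<bar> + 2 \<le> \<bar>i\<bar>" for i
        proof -
          have "i < k \<or> k' + 1 < i" using that by linarith
          then have "h i < h k \<or> h (k' + 1) < h i" using h(1) by (auto simp: strict_mono_less)
          with k k' show ?thesis by linarith
        qed
        then show ?thesis by blast
      qed
      then obtain N where N: "\<And>m i. N m \<le> \<bar>i\<bar> \<Longrightarrow> \<not> (lo m \<le> h i \<and> h i < hi m)" by metis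
      have "N m \<le> (\<Sum>m\<in>M. \<bar>N m\<bar>)" if "m \<in> M" for m
        using member_le_sum[of m M "\<lambda>m. \<bar>N m\<bar>"] \<open>finite M\<close> that by auto
      then show ?thesis using N by (meson order_trans)
    qed
    obtain N1 where N1: "\<And>i. N1 \<le> \<bar>i\<bar> \<Longrightarrow> \<not> (\<exists>m\<in>M. R m West \<le> gx i \<and> gx i < R m East)"
      using bd[OF gx(1,3), of "\<lambda>m. R m West" "\<lambda>m. R m East"] by blast
    obtain N2 where N2: "\<And>i. N2 \<le> \<bar>i\<bar> \<Longrightarrow> \<not> (\<exists>m\<in>M. R m South \<le> gy i \<and> gy i < R m North)"
      using bd[OF gy(1,3), of "\<lambda>m. R m South" "\<lambda>m. R m North"] by blast
    have "\<not> S i j" if "max N1 N2 \<le> \<bar>i\<bar> \<or> max N1 N2 \<le> \<bar>j\<bar>" for i j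
      using N1[of i] N2[of j] that unfolding S_def filled_ne_def by auto
    then show thesis by (rule that)
  qed
  obtain l r s t where lr: "l < a" "a < r" "s < b" "b < t"
    and "\<forall>i j. s \<le> j \<and> j < b \<and> l - 1 \<le> i \<and> i \<le> r \<longrightarrow> (S i j \<longleftrightarrow> l \<le> i \<and> i < r)"
      "\<forall>i. l - 1 \<le> i \<and> i \<le> r \<longrightarrow> \<not> S i (s - 1)"
      "\<forall>i j. b \<le> j \<and> j < t \<and> l - 1 \<le> i \<and> i \<le> a \<longrightarrow> (S i j \<longleftrightarrow> l \<le> i \<and> i < a)"
      "\<forall>i. l - 1 \<le> i \<and> i \<le> a \<longrightarrow> \<not> S i t" "\<forall>i. a \<le> i \<and> i \<le> r \<longrightarrow> \<not> S i b"
    using L_shape_of_cells[of a b S n, OF loc corner n] by blast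
  then have rows: "\<And>i j. s \<le> j \<Longrightarrow> j < b \<Longrightarrow> l - 1 \<le> i \<Longrightarrow> i \<le> r \<Longrightarrow> S i j \<longleftrightarrow> l \<le> i \<and> i < r"
    "\<And>i. l - 1 \<le> i \<Longrightarrow> i \<le> r \<Longrightarrow> \<not> S i (s - 1)"
    "\<And>i j. b \<le> j \<Longrightarrow> j < t \<Longrightarrow> l - 1 \<le> i \<Longrightarrow> i \<le> a \<Longrightarrow> S i j \<longleftrightarrow> l \<le> i \<and> i < a"
    "\<And>i. l - 1 \<le> i \<Longrightarrow> i \<le> a \<Longrightarrow> \<not> S i t"
    "\<And>i. a \<le> i \<Longrightarrow> i \<le> r \<Longrightarrow> \<not> S i b"
    by blast+
  define Q where "Q = L_region (gx l) px (gx r) (gy s) py (gy t)"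
  have cell: "\<exists>k. c \<le> k \<and> k < d \<and> h k \<le> x \<and> x \<le> h (k + 1)"
    if "strict_mono h" "\<And>x. \<exists>k. h k \<le> x \<and> x < h (k + 1)" "c < d" "h c \<le> x" "x \<le> h d"
    for h :: "int \<Rightarrow> real" and c d x
    using grid_interval_cell[OF that(1,2), of "h c" "h d" x] that
    by (auto simp: strict_mono_less strict_mono_less_eq)
  have QP: "Q \<subseteq> region M R"
  proof
    fix z assume "z \<in> Q"
    obtain x y where z: "z = (x, y)" by (cases z)
    have "gx a \<le> gx r" using lr by (simp add: mx)
    then have c: "gx l \<le> x \<and> x \<le> gx r \<and> gy s \<le> y \<and> y \<le> gy b \<or> gx l \<le> x \<and> x \<le> gx a \<and> gy b \<le> y \<and> y \<le> gy t"
      using \<open>z \<in> Q\<close> unfolding z Q_def L_region_def a b by auto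
    from c show "z \<in> region M R"
    proof
      assume h: "gx l \<le> x \<and> x \<le> gx r \<and> gy s \<le> y \<and> y \<le> gy b"
      obtain i where "l \<le> i" "i < r" "gx i \<le> x" "x \<le> gx (i + 1)"
        using cell[OF gx(1,3), of l r x] lr h by auto
      moreover obtain j where "s \<le> j" "j < b" "gy j \<le> y" "y \<le> gy (j + 1)"
        using cell[OF gy(1,3), of s b y] lr h by auto
      ultimately show ?thesis unfolding z reg using rows(1)[of j i] by auto
    next
      assume h: "gx l \<le> x \<and> x \<le> gx a \<and> gy b \<le> y \<and> y \<le> gy t"
      obtain i where "l \<le> i" "i < a" "gx i \<le> x" "x \<le> gx (i + 1)"
        using cell[OF gx(1,3), of l a x] lr h by auto
      moreover obtain j where "b \<le> j" "j < t" "gy j \<le> y" "y \<le> gy (j + 1)"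
        using cell[OF gy(1,3), of b t y] lr h by auto
      ultimately show ?thesis unfolding z reg using rows(3)[of j i] by auto
    qed
  qed
  \<comment> \<open>Each rectangle of \<open>Q\<close> is widened by one grid step, so the only
    further cells that \<open>U\<close> meets are the border cells known to be empty.\<close>
  define U where "U = {gx (l - 1)<..<gx (r + 1)} \<times> {gy (s - 1)<..<gy (b + 1)} \<union>
      {gx (l - 1)<..<gx (a + 1)} \<times> {gy (s - 1)<..<gy (t + 1)}"
  have "open U" unfolding U_def by (intro open_Un open_Times) auto
  have "Q \<subseteq> U"
  proof -
    have "gx (l - 1) < gx l" "gx r < gx (r + 1)" "gx a < gx (a + 1)"
      "gy (s - 1) < gy s" "gy b < gy (b + 1)" "gy t < gy (t + 1)"
      by (simp_all add: mx my)
    then show ?thesis unfolding U_def Q_def L_region_def a b by auto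
  qed
  have UQ: "U \<inter> region M R \<subseteq> Q"
  proof
    fix z assume "z \<in> U \<inter> region M R"
    then obtain x y where z: "z = (x, y)" "(x, y) \<in> U" "(x, y) \<in> region M R" by (cases z) auto
    obtain i j where ij: "S i j" "gx i \<le> x" "x \<le> gx (i + 1)" "gy j \<le> y" "y \<le> gy (j + 1)"
      using z(3) unfolding reg by blast
    have "gx (l - 1) < gx (i + 1)" "gy (s - 1) < gy (j + 1)"
      "gx i < gx (r + 1) \<and> gy j < gy (b + 1) \<or> gx i < gx (a + 1) \<and> gy j < gy (t + 1)"
      using z(2) ij unfolding U_def by auto
    then have b1: "l - 1 \<le> i" "s - 1 \<le> j" "i \<le> r \<and> j \<le> b \<or> i \<le> a \<and> j \<le> t"
      unfolding mx my by auto
    have "j \<noteq> s - 1" using rows(2)[of i] ij(1) b1 lr by auto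
    then have b2: "s \<le> j" using b1 by simp
    have "l \<le> i \<and> i < r \<and> j < b \<or> l \<le> i \<and> i < a \<and> j < t"
    proof (cases "j < b")
      case True
      then show ?thesis using rows(1)[of j i] ij(1) b1 b2 lr by auto
    next
      case False
      have "i \<le> a"
      proof (rule ccontr)
        assume "\<not> i \<le> a"
        then have "i \<le> r" "j = b" using b1 False by auto
        then show False using rows(5)[of i] \<open>\<not> i \<le> a\<close> ij(1) by auto
      qed
      then have "j < t" using rows(4)[of i] ij(1) b1 lr by (cases "j = t") auto
      then show ?thesis using rows(3)[of j i] \<open>i \<le> a\<close> ij(1) b1 False by auto
    qed
    then have "gx l \<le> gx i \<and> gx (i + 1) \<le> gx r \<and> gy s \<le> gy j \<and> gy (j + 1) \<le> gy b \<or>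
        gx l \<le> gx i \<and> gx (i + 1) \<le> gx a \<and> gy s \<le> gy j \<and> gy (j + 1) \<le> gy t"
      unfolding mx my using b2 by auto
    then show "z \<in> Q"
      unfolding z(1) Q_def L_region_def a b using ij by auto
  qed
  \<comment> \<open>The walk along the rows says nothing about cells far from \<open>Q\<close>;
    connectedness excludes them.\<close>
  have "connected (frontier (region M R))"
    unfolding g(2)[symmetric] using g(1) by (simp add: connected_simple_path_image)
  then have conn: "connected (region M R)"
    by (rule connected_if_connected_frontier[OF compact_region[OF \<open>finite M\<close>]])
  have "closed Q" unfolding Q_def L_region_def by (intro closed_Un closed_Times) auto
  have "gx l \<le> px" "gx l \<le> gx r" "gy s \<le> py" unfolding a b mx my using lr by auto
  then have "(gx l, gy s) \<in> Q" unfolding Q_def L_region_def by auto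
  then have "Q \<inter> region M R \<noteq> {}" using QP by blast
  with conn \<open>closed Q\<close> \<open>open U\<close> \<open>Q \<subseteq> U\<close> UQ have "region M R \<subseteq> Q"
    by (rule connected_subset_clopen)
  then have "region M R = Q" using QP by blast
  moreover have "gx l < px" "px < gx r" "gy s < py" "py < gy t"
    unfolding a b mx my using lr by simp_all
  ultimately show thesis unfolding Q_def by (intro that)
qed

section \<open>The plan with its notch in the north-east\<close>

text \<open>The right-hand side of the theorem under a name, so that symmetries can transport
  it.\<close>

definition wall_triple :: "'m set \<Rightarrow> ('m \<Rightarrow> rect) \<Rightarrow> (real \<times> real) set \<Rightarrow> (real \<times> real) set \<Rightarrow> bool" where
  "wall_triple M R W1 W2 \<longleftrightarrow>
    (\<exists>A B C. distinct [A, B, C] \<and>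
       (\<forall>X\<in>{A, B, C}. exterior_module M R X \<and> (has_side_on R X W1 \<or> has_side_on R X W2)) \<and>
       ((vertically_adjacent R A B \<and> horizontally_adjacent R B C) \<or>
        (horizontally_adjacent R A B \<and> vertically_adjacent R B C)))"

lemma wall_triple_commute: "wall_triple M R W W' \<longleftrightarrow> wall_triple M R W' W"
  unfolding wall_triple_def by blast

lemma share_segment_mono: "share_segment S T \<Longrightarrow> T \<subseteq> T' \<Longrightarrow> share_segment S T'"
  unfolding share_segment_def by blast

text \<open>The points at distance \<open>2 * h\<close> from \<open>p\<close> on the two half-axes
  bounding the missing quadrant belong to \<open>P\<close>, but their midpoint lies in that
  quadrant.\<close>

lemma convex_no_concave_corner:
  assumes "convex P"
  shows "\<not> concave_corner P p"
proof
  assume "concave_corner P p"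
  then obtain sx sy where s: "sx \<in> {-1, 1}" "sy \<in> {-1, 1}" and "concave_towards sx sy P p"
    unfolding concave_corner_iff by blast
  then obtain e where e: "e > 0" "\<And>u v. \<bar>u\<bar> < e \<Longrightarrow> \<bar>v\<bar> < e \<Longrightarrow> p + (u, v) \<in> P \<longleftrightarrow> \<not> (sx * u > 0 \<and> sy * v > 0)"
    unfolding concave_towards_def by blast
  define h where "h = e / 4"
  have h: "h > 0" "2 * h < e" using e(1) by (auto simp: h_def)
  have sq: "sx * sx = 1" "sy * sy = 1" "\<bar>sx\<bar> = 1" "\<bar>sy\<bar> = 1" using s by auto
  have "p + (2 * h * sx, 0) \<in> P" "p + (0, 2 * h * sy) \<in> P"
    using h sq by (subst e(2); simp add: abs_mult)+
  then have "(1 / 2) *\<^sub>R (p + (2 * h * sx, 0)) + (1 / 2) *\<^sub>R (p + (0, 2 * h * sy)) \<in> P"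
    by (intro convexD[OF assms]) auto
  also have "(1 / 2) *\<^sub>R (p + (2 * h * sx, 0)) + (1 / 2) *\<^sub>R (p + (0, 2 * h * sy)) = p + (h * sx, h * sy)"
    by (cases p) (simp add: algebra_simps)
  finally have "\<not> (sx * (h * sx) > 0 \<and> sy * (h * sy) > 0)"
    using h sq by (subst (asm) e(2)) (auto simp: abs_mult)
  moreover have "sx * (h * sx) = h * (sx * sx)" "sy * (h * sy) = h * (sy * sy)"
    by (simp_all add: algebra_simps)
  ultimately show False using h(1) sq by simp
qed

text \<open>The curve is \<open>rectpath\<close> in the complex plane, carried over by the linear
  bijection to pairs of reals.\<close>

lemma rectangle_frontier_loop:
  fixes a b c d :: real
  assumes "a < b" "c < d"
  shows "\<exists>g. simple_path g \<and> pathfinish g = pathstart g \<and> path_image g = frontier ({a..b} \<times> {c..d})"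
proof -
  define f :: "complex \<Rightarrow> real \<times> real" where "f z = (Re z, Im z)" for z
  have lin: "linear f" by (intro linearI) (auto simp: f_def)
  have inj: "inj f" by (auto simp: inj_on_def f_def complex_eq_iff)
  define g where "g = rectpath (Complex a c) (Complex b d)"
  have "simple_path (f \<circ> g)"
    unfolding simple_path_linear_image_eq[OF lin inj] g_def using assms by auto
  moreover have "pathfinish (f \<circ> g) = pathstart (f \<circ> g)"
    by (simp add: g_def pathfinish_compose pathstart_compose)
  moreover have "path_image (f \<circ> g) = frontier ({a..b} \<times> {c..d})"
  proof -
    have "path_image g = cbox (Complex a c) (Complex b d) - box (Complex a c) (Complex b d)"
      unfolding g_def using assms by (intro path_image_rectpath_cbox_minus_box) auto
    then have "path_image (f \<circ> g) = f ` (cbox (Complex a c) (Complex b d) - box (Complex a c) (Complex b d))"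
      by (simp add: path_image_compose)
    also have "\<dots> = {a..b} \<times> {c..d} - {a<..<b} \<times> {c<..<d}"
    proof (intro set_eqI iffI)
      fix z assume "z \<in> {a..b} \<times> {c..d} - {a<..<b} \<times> {c<..<d}"
      then have "z = f (Complex (fst z) (snd z))"
        "Complex (fst z) (snd z) \<in> cbox (Complex a c) (Complex b d) - box (Complex a c) (Complex b d)"
        by (auto simp: f_def in_cbox_complex_iff in_box_complex_iff)
      then show "z \<in> f ` (cbox (Complex a c) (Complex b d) - box (Complex a c) (Complex b d))" by blast
    qed (auto simp: f_def in_cbox_complex_iff in_box_complex_iff)
    also have "\<dots> = frontier ({a..b} \<times> {c..d})"
      by (simp add: frontier_def interior_Times closure_Times)
    finally show ?thesis .
  qed
  ultimately show ?thesis by blast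
qed

text \<open>Normal position: the notch points north-east, and \<open>B\<close> ends at
  \<open>px\<close> and straddles the height \<open>py\<close>. The assumption \<open>se\<close>
  provides the module \<open>A\<close> below the notch. Below, \<open>H\<close> is the floor of the
  notch and \<open>V\<close> its west wall.\<close>

locale notched_plan =
  fixes M :: "'m set" and R :: "'m \<Rightarrow> rect" and B :: 'm and x0 px x1 y0 py y1 :: real
  assumes fp: "floor_plan M R" and one_corner: "num_concave_corners M R = 1"
    and ord: "x0 < px" "px < x1" "y0 < py" "py < y1"
    and reg: "region M R = L_region x0 px x1 y0 py y1"
    and B: "B \<in> M" "R B East = px" "R B South < py" "py < R B North"
    and se: "filled_se M R px py"
begin

abbreviation H where "H \<equiv> {px..x1} \<times> {py}"
abbreviation V where "V \<equiv> {px} \<times> {py..y1}"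

lemma valid: "valid_plan M R"
  using fp by (simp add: floor_plan_iff)

lemmas pos = valid_planD(2,3)[OF valid]

lemma module_bounds:
  assumes "m \<in> M"
  shows "x0 \<le> R m West" "R m East \<le> x1" "y0 \<le> R m South" "R m North \<le> y1"
    "R m North \<le> py \<or> R m East \<le> px"
proof -
  have "(R m East, R m North) \<in> region M R" "(R m West, R m South) \<in> region M R"
    unfolding mem_region using assms pos[OF assms] by (auto intro!: bexI[of _ m])
  then show "x0 \<le> R m West" "R m East \<le> x1" "y0 \<le> R m South" "R m North \<le> y1"
    "R m North \<le> py \<or> R m East \<le> px"
    using ord unfolding reg L_region_def by auto
qed

lemma notch_frontier:
  assumes "(x, y) \<in> region M R" "px \<le> x" "py \<le> y"
  shows "(x, y) \<in> frontier (region M R)"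
proof (rule in_frontier_pairI)
  fix e :: real assume "e > 0"
  then have "\<bar>e / 2\<bar> < e" "\<bar>e / 2\<bar> < e" "(x + e / 2, y + e / 2) \<notin> region M R"
    using assms unfolding reg L_region_def by auto
  then show "\<exists>u v. \<bar>u\<bar> < e \<and> \<bar>v\<bar> < e \<and> (x + u, y + v) \<notin> region M R" by blast
qed (rule assms(1))

lemma walls_frontier: "H \<subseteq> frontier (region M R)" "V \<subseteq> frontier (region M R)"
proof -
  have "(x, y) \<in> region M R" if "(x, y) \<in> H \<union> V" for x y
    using that ord unfolding reg L_region_def by auto
  then show "H \<subseteq> frontier (region M R)" "V \<subseteq> frontier (region M R)"
    using notch_frontier by auto
qed

lemma interior_points:
  assumes "x0 < x" "y0 < y" "x < px \<and> y < y1 \<or> x < x1 \<and> y < py"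
  shows "(x, y) \<notin> frontier (region M R)"
proof -
  have "(x, y) \<in> {x0<..<px} \<times> {y0<..<y1} \<union> {x0<..<x1} \<times> {y0<..<py}"
    using assms by auto
  moreover have "{x0<..<px} \<times> {y0<..<y1} \<union> {x0<..<x1} \<times> {y0<..<py} \<subseteq> region M R"
    unfolding reg L_region_def by auto
  moreover have "open ({x0<..<px} \<times> {y0<..<y1} \<union> {x0<..<x1} \<times> {y0<..<py})"
    by (intro open_Un open_Times) auto
  ultimately have "(x, y) \<in> interior (region M R)" by (meson interiorI)
  then show ?thesis by (simp add: frontier_def)
qed

text \<open>A frontier segment through the corner cannot continue west or south, since the points
  there are interior, nor past the outer bounds of the L. It is thus contained in \<open>H\<close>
  or \<open>V\<close>, and maximality gives equality.\<close>

lemma boundary_wall_at_corner: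
  assumes bw: "boundary_wall (region M R) W" and p: "(px, py) \<in> W"
  shows "W = H \<or> W = V"
proof -
  have fr: "W \<subseteq> frontier (region M R)"
    and mx: "\<And>a b. W \<subseteq> closed_segment a b \<Longrightarrow> closed_segment a b \<subseteq> frontier (region M R) \<Longrightarrow> closed_segment a b = W"
    using bw unfolding boundary_wall_def by blast+
  have "closed (region M R)"
    using compact_imp_closed compact_region valid_planD(1)[OF valid] by blast
  then have fr': "W \<subseteq> region M R" using fr frontier_subset_closed by blast
  have Veq: "V = closed_segment (px, py) (px, y1)" and Heq: "H = closed_segment (px, py) (x1, py)"
    using ord by (simp_all add: closed_segment_vertical closed_segment_horizontal closed_segment_eq_real_ivl)
  from bw show ?thesis
  proof (cases rule: boundary_wall_cases)
    case (vertical x c d)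
    with p have x: "x = px" "c \<le> py" "py \<le> d" by auto
    have "py \<le> c"
    proof (rule ccontr)
      assume "\<not> py \<le> c"
      \<comment> \<open>If \<open>W\<close> continued south, this would be a point of it strictly
        between \<open>y0\<close> and \<open>py\<close>.\<close>
      define y where "y = (max c y0 + py) / 2"
      have y: "c \<le> y" "y0 < y" "y < py" using \<open>\<not> py \<le> c\<close> ord by (auto simp: y_def)
      then have "(px, y) \<in> W" using x vertical by auto
      then show False using interior_points[of px y] y ord fr by auto
    qed
    moreover have "d \<le> y1"
    proof -
      have "(px, d) \<in> W" using x vertical by auto
      then show ?thesis using fr' ord unfolding reg L_region_def by auto
    qed
    ultimately have "W \<subseteq> V" using vertical(2) x by auto
    then have "V = W" using mx walls_frontier(2) unfolding Veq by blast
    then show ?thesis by simp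
  next
    case (horizontal y c d)
    with p have y: "y = py" "c \<le> px" "px \<le> d" by auto
    have "px \<le> c"
    proof (rule ccontr)
      assume "\<not> px \<le> c"
      define x where "x = (max c x0 + px) / 2"
      have x: "c \<le> x" "x0 < x" "x < px" using \<open>\<not> px \<le> c\<close> ord by (auto simp: x_def)
      then have "(x, py) \<in> W" using y horizontal by auto
      then show False using interior_points[of x py] x ord fr by auto
    qed
    moreover have "d \<le> x1"
    proof -
      have "(d, py) \<in> W" using y horizontal by auto
      then show ?thesis using fr' ord unfolding reg L_region_def by auto
    qed
    ultimately have "W \<subseteq> H" using horizontal(2) y by auto
    then have "H = W" using mx walls_frontier(1) unfolding Heq by blast
    then show ?thesis by simp
  qed
qed

text \<open>\<open>B\<close> stands on both sides of the height \<open>py\<close>, so a top side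
  partly on \<open>H\<close> cannot extend west of \<open>px\<close>. This matters because a stretch
  moves whole sides: none moved with \<open>H\<close> protrudes beyond it.\<close>

lemma side_on_H_iff:
  assumes m: "m \<in> M"
  shows "share_segment (side (R m) e) H \<longleftrightarrow> e = North \<and> R m North = py \<and> px \<le> R m West"
proof (cases e)
  case South
  have "\<not> (R m South = py \<and> max (R m West) px < min (R m East) x1)"
    using module_bounds[OF m] pos[OF m] by auto
  then show ?thesis using South by (simp add: share_segment_horizontal)
next
  case North
  have "R m North = py \<and> max (R m West) px < min (R m East) x1 \<longleftrightarrow> R m North = py \<and> px \<le> R m West"
  proof
    assume a: "R m North = py \<and> max (R m West) px < min (R m East) x1"
    then have "m \<noteq> B" using B by auto
    then show "R m North = py \<and> px \<le> R m West"
      using valid_planD(4)[OF valid m B(1)] pos[OF m] pos[OF B(1)] a B by auto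
  next
    assume "R m North = py \<and> px \<le> R m West"
    then show "R m North = py \<and> max (R m West) px < min (R m East) x1"
      using module_bounds[OF m] pos[OF m] ord by auto
  qed
  then show ?thesis using North by (simp add: share_segment_horizontal)
qed (simp_all add: share_segment_perpendicular)

text \<open>Unlike on \<open>H\<close>, a side may overhang here: the East side of \<open>B\<close>
  continues below the corner.\<close>

lemma side_on_V_iff:
  assumes m: "m \<in> M"
  shows "share_segment (side (R m) e) V \<longleftrightarrow> e = East \<and> R m East = px \<and> py < R m North"
proof (cases e)
  case West
  have "\<not> (R m West = px \<and> max (R m South) py < min (R m North) y1)"
    using module_bounds[OF m] pos[OF m] by auto
  then show ?thesis using West by (simp add: share_segment_vertical)
next
  case East
  have "R m East = px \<and> max (R m South) py < min (R m North) y1 \<longleftrightarrow> R m East = px \<and> py < R m North"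
    using module_bounds[OF m] pos[OF m] ord by auto
  then show ?thesis using East by (simp add: share_segment_vertical)
qed (simp_all add: share_segment_perpendicular)

lemma has_side_on_iff:
  assumes "m \<in> M"
  shows "has_side_on R m H \<longleftrightarrow> R m North = py \<and> px \<le> R m West"
    "has_side_on R m V \<longleftrightarrow> R m East = px \<and> py < R m North"
  unfolding has_side_on_def side_on_H_iff[OF assms] side_on_V_iff[OF assms] by blast+

lemma exterior_moduleI:
  assumes "m \<in> M" "has_side_on R m H \<or> has_side_on R m V"
  shows "exterior_module M R m"
  using assms share_segment_mono[OF _ walls_frontier(1)] share_segment_mono[OF _ walls_frontier(2)]
  unfolding exterior_module_def has_side_on_def by blast

lemma wall_triple_iff:
  "wall_triple M R H V \<longleftrightarrow>
    (\<exists>A\<in>M. \<exists>B\<in>M. \<exists>C\<in>M. distinct [A, B, C] \<and>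
       (\<forall>X\<in>{A, B, C}. has_side_on R X H \<or> has_side_on R X V) \<and>
       ((vertically_adjacent R A B \<and> horizontally_adjacent R B C) \<or>
        (horizontally_adjacent R A B \<and> vertically_adjacent R B C)))"
proof -
  have "exterior_module M R X \<and> (has_side_on R X H \<or> has_side_on R X V) \<longleftrightarrow>
      X \<in> M \<and> (has_side_on R X H \<or> has_side_on R X V)" for X
    using exterior_moduleI exterior_module_def by metis
  then show ?thesis unfolding wall_triple_def by (simp add: Bex_def) blast
qed

text \<open>The notch leaves no room above \<open>A\<close> or to the right of \<open>C\<close>, and
  \<open>A\<close> ends strictly below the foot of \<open>C\<close>. The same three modules
  therefore block every stretch and form the triple.\<close>

lemma short_neighbour:
  assumes short: "R B North < y1"
  shows "\<not> trivial_plan M R" "wall_triple M R H V"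
proof -
  obtain A where A: "A \<in> M" "R A West \<le> px" "px < R A East" "R A South < py" "py \<le> R A North"
    using se unfolding filled_se_def by blast
  have AN: "R A North = py" using module_bounds[OF A(1)] A by auto
  have "A \<noteq> B" using A B by auto
  then have AW: "R A West = px"
    using valid_planD(4)[OF valid A(1) B(1)] pos[OF B(1)] A B AN by auto
  have "filled_nw M R px (R B North)"
  proof -
    obtain e where e: "e > 0" "\<And>u v. \<bar>u\<bar> < e \<Longrightarrow> \<bar>v\<bar> < e \<Longrightarrow> (px + u, R B North + v) \<in> region M R \<longleftrightarrow>
      u \<ge> 0 \<and> v \<ge> 0 \<and> filled_ne M R px (R B North) \<or> u \<le> 0 \<and> v \<ge> 0 \<and> filled_nw M R px (R B North) \<or>
      u \<ge> 0 \<and> v \<le> 0 \<and> filled_se M R px (R B North) \<or> u \<le> 0 \<and> v \<le> 0 \<and> filled_sw M R px (R B North)"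
      using region_local[OF valid] by blast
    \<comment> \<open>The point offset by \<open>- h\<close> and \<open>h\<close> from the top right
      corner of \<open>B\<close> still lies in the upper arm, because \<open>B\<close> stops short
      of \<open>y1\<close>.\<close>
    define h where "h = min (e / 2) (min (px - x0) (y1 - R B North))"
    have h: "h > 0" "h < e" "h \<le> px - x0" "h \<le> y1 - R B North"
      using e(1) ord short by (auto simp: h_def)
    have "(px + - h, R B North + h) \<in> region M R"
      using h ord B unfolding reg L_region_def by auto
    then show ?thesis using e(2)[of "- h" h] h by auto
  qed
  then obtain C where C: "C \<in> M" "R C West < px" "px \<le> R C East" "R C South \<le> R B North" "R B North < R C North"
    unfolding filled_nw_def by blast
  have CE: "R C East = px" using module_bounds[OF C(1)] C B by auto
  have "C \<noteq> B" using C by auto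
  then have CS: "R C South = R B North"
    using valid_planD(4)[OF valid C(1) B(1)] pos[OF B(1)] pos[OF C(1)] C B CE by auto
  have "A \<noteq> C" using A CE by auto
  have AB: "right_of R A B" unfolding right_of_def using A B AN AW by auto
  have CB: "above R C B"
    unfolding above_def using C B CS CE pos[OF B(1)] by auto
  show "\<not> trivial_plan M R"
  proof (rule blocked_corner_imp_nontrivial[OF valid one_corner A(1) B(1) C(1) AB CB])
    fix D assume D: "D \<in> M"
    show "\<not> above R D A"
      using module_bounds[OF D] pos[OF D] AN AW unfolding above_def by auto
    show "\<not> right_of R D C"
      using module_bounds[OF D] pos[OF D] CE CS B unfolding right_of_def by auto
  next
    show "\<not> right_of R A C" unfolding right_of_def using AN CS B by auto
    show "\<not> above R C A" unfolding above_def using AN CS B by auto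
  qed
  have "horizontally_adjacent R A B" using horizontally_adjacent_iff[OF valid A(1) B(1)] AB by blast
  moreover have "vertically_adjacent R B C" using vertically_adjacent_iff[OF valid B(1) C(1)] CB by blast
  moreover have "\<forall>X\<in>{A, B, C}. has_side_on R X H \<or> has_side_on R X V"
    using has_side_on_iff[OF A(1)] has_side_on_iff[OF B(1)] has_side_on_iff[OF C(1)] AN AW CE CS B C
    by auto
  ultimately show "wall_triple M R H V"
    unfolding wall_triple_iff using A(1) B(1) C(1) \<open>A \<noteq> B\<close> \<open>C \<noteq> B\<close> \<open>A \<noteq> C\<close>
    by (intro bexI[of _ A] bexI[of _ B] bexI[of _ C]) auto
qed

text \<open>\<open>B\<close> occupies the whole length of \<open>V\<close> from the inside, which
  leaves no room for another module.\<close>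

lemma full_neighbour_unique:
  assumes full: "R B North = y1" and m: "m \<in> M" "R m East = px" "py < R m North"
  shows "m = B"
  using valid_planD(4)[OF valid m(1) B(1)] pos[OF m(1)] pos[OF B(1)] module_bounds[OF m(1)] m B full
  by (smt (verit))

text \<open>Both forms of the triple contain a vertical adjacency. Modules along \<open>H\<close>
  all have their top at \<open>py\<close>, and along \<open>V\<close> there is only
  \<open>B\<close>, which begins below \<open>py\<close> and ends at \<open>y1\<close>; no two of
  these can be stacked.\<close>

lemma full_neighbour_no_triple:
  assumes full: "R B North = y1"
  shows "\<not> wall_triple M R H V"
proof -
  have no: "\<not> above R Y X"
    if "X \<in> M" "Y \<in> M" "has_side_on R X H \<or> has_side_on R X V" "has_side_on R Y H \<or> has_side_on R Y V" for X Y
  proof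
    assume ab: "above R Y X"
    have X: "R X North = py \<or> X = B"
      using that has_side_on_iff[OF that(1)] full_neighbour_unique[OF full that(1)] by blast
    have Y: "R Y North = py \<or> Y = B"
      using that has_side_on_iff[OF that(2)] full_neighbour_unique[OF full that(2)] by blast
    show False
      using X Y ab pos[OF that(1)] pos[OF that(2)] module_bounds[OF that(2)] B full ord
      unfolding above_def by auto
  qed
  show ?thesis
  proof
    assume "wall_triple M R H V"
    then obtain X Y where "X \<in> M" "Y \<in> M" "has_side_on R X H \<or> has_side_on R X V"
      "has_side_on R Y H \<or> has_side_on R Y V" "vertically_adjacent R X Y"
      unfolding wall_triple_iff by blast
    then show False using no vertically_adjacent_iff[OF valid] by blast
  qed
qed

lemma full_neighbour_trivial:
  assumes full: "R B North = y1" and wall: "boundary_wall (region M R) H"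
  shows "trivial_plan M R"
proof -
  define R' where "R' i e = (if share_segment (side (R i) e) H then R i e + (y1 - py) else R i e)" for i e
  define U where "U = {m \<in> M. R m North = py \<and> px \<le> R m West}"
  have R': "R' m West = R m West" "R' m East = R m East" "R' m South = R m South"
    "R' m North = (if m \<in> U then y1 else R m North)" if "m \<in> M" for m
    using that by (simp_all add: R'_def side_on_H_iff U_def del: side.simps)
  have U: "R m North = py" "px \<le> R m West" "m \<in> M" if "m \<in> U" for m
    using that by (auto simp: U_def)
  have pos': "R' m West < R' m East \<and> R' m South < R' m North" if "m \<in> M" for m
    using pos[OF that] U[of m] ord R'[OF that] by auto
  have ov': "R' i East \<le> R' j West \<or> R' j East \<le> R' i West \<or> R' i North \<le> R' j South \<or> R' j North \<le> R' i South"
    if "i \<in> M" "j \<in> M" "i \<noteq> j" for i j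
    using valid_planD(4)[OF valid that] R'[OF that(1)] R'[OF that(2)] U[of i] U[of j]
      pos[OF that(1)] pos[OF that(2)] module_bounds[OF that(1)] module_bounds[OF that(2)]
    by (smt (verit))
  have V': "valid_plan M R'"
    unfolding valid_plan_def overlap_free_def using valid_planD(1)[OF valid] pos' ov' by blast
  have reg': "region M R' = {x0..x1} \<times> {y0..y1}"
  proof (intro set_eqI iffI)
    fix z assume "z \<in> region M R'"
    then obtain x y m where z: "z = (x, y)" and m: "m \<in> M" "R' m West \<le> x" "x \<le> R' m East"
      "R' m South \<le> y" "y \<le> R' m North"
      by (cases z) (auto simp: mem_region)
    then show "z \<in> {x0..x1} \<times> {y0..y1}"
      using R'[OF m(1)] module_bounds[OF m(1)] by (auto split: if_splits)
  next
    fix z assume "z \<in> {x0..x1} \<times> {y0..y1}"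
    then obtain x y where z: "z = (x, y)" "x0 \<le> x" "x \<le> x1" "y0 \<le> y" "y \<le> y1" by auto
    show "z \<in> region M R'"
    proof (cases "(x, y) \<in> region M R")
      case True
      then obtain m where m: "m \<in> M" "R m West \<le> x" "x \<le> R m East" "R m South \<le> y" "y \<le> R m North"
        unfolding mem_region by blast
      then show ?thesis
        unfolding z(1) mem_region using R'[OF m(1)] z by (intro bexI[of _ m]) auto
    next
      case False
      then have xy: "px < x" "py < y" using z ord unfolding reg L_region_def by auto
      \<comment> \<open>A point of the notch is covered by the lifted module below it, found at the
        foot \<open>(x, py)\<close>. \<open>B\<close> keeps that module east of \<open>px\<close>,
        so its top lies on \<open>H\<close> and is lifted.\<close>
      have "(x, py) \<in> region M R" using xy z ord unfolding reg L_region_def by auto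
      then obtain m where m: "m \<in> M" "R m West \<le> x" "x \<le> R m East" "R m South \<le> py" "py \<le> R m North"
        unfolding mem_region by blast
      have N: "R m North = py" using module_bounds[OF m(1)] m xy by auto
      have "m \<noteq> B" using N B by auto
      then have "px \<le> R m West"
        using valid_planD(4)[OF valid m(1) B(1)] pos[OF m(1)] pos[OF B(1)] m B N xy by auto
      then have "m \<in> U" using m(1) N by (simp add: U_def)
      then show ?thesis
        unfolding z(1) mem_region using R'[OF m(1)] m xy z by (intro bexI[of _ m]) auto
    qed
  qed
  have fp': "floor_plan M R'"
    unfolding floor_plan_iff reg' using V' ord by (intro conjI rectangle_frontier_loop) auto
  \<comment> \<open>Lifting could create contact only across the line of \<open>V\<close>, with a
    module reaching above \<open>py\<close> there. This is \<open>B\<close> alone, which straddles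
    \<open>py\<close> and so touched the lifted module already.\<close>
  have right: "right_of R' j i \<longleftrightarrow> right_of R j i" if ij: "i \<in> M" "j \<in> M" for i j
  proof
    assume r: "right_of R' j i"
    then have e: "R i East = R j West" using R'[OF ij(1)] R'[OF ij(2)] by (simp add: right_of_def)
    have i: "i = B" if "R i East = px" "py < R i North"
      using full_neighbour_unique[OF full ij(1) that] .
    show "right_of R j i"
      using r e i R'[OF ij(1)] R'[OF ij(2)] U[of i] U[of j] pos[OF ij(1)] pos[OF ij(2)]
        module_bounds[OF ij(1)] module_bounds[OF ij(2)] B
      unfolding right_of_def by (smt (verit))
  next
    assume "right_of R j i"
    then show "right_of R' j i"
      using R'[OF ij(1)] R'[OF ij(2)] module_bounds[OF ij(1)] module_bounds[OF ij(2)]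
      unfolding right_of_def by auto
  qed
  \<comment> \<open>Modules along \<open>H\<close> have nothing above them before or after lifting,
    and no South side moves.\<close>
  have above: "above R' j i \<longleftrightarrow> above R j i" if ij: "i \<in> M" "j \<in> M" for i j
    using R'[OF ij(1)] R'[OF ij(2)] U[of i] pos[OF ij(1)] pos[OF ij(2)]
      module_bounds[OF ij(1)] module_bounds[OF ij(2)]
    unfolding above_def by (smt (verit))
  have "adjacent R' i j \<longleftrightarrow> adjacent R i j" if "i \<in> M" "j \<in> M" for i j
    using that adjacent_iff[OF V' that] adjacent_iff[OF valid that] right above by simp
  then have "stretch M R R'"
    unfolding stretch_def using wall fp' by (auto simp: R'_def)
  moreover have "num_concave_corners M R' = 0"
  proof -
    have "convex (region M R')" unfolding reg' by (intro convex_Times) auto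
    then show ?thesis using convex_no_concave_corner by (simp add: num_concave_corners_def)
  qed
  ultimately show ?thesis
    unfolding trivial_plan_def one_corner by (intro exI[of _ R']) auto
qed

lemma nontrivial_iff_wall_triple:
  assumes "boundary_wall (region M R) W1" "boundary_wall (region M R) W2" "W1 \<noteq> W2"
    and "(px, py) \<in> W1" "(px, py) \<in> W2"
  shows "\<not> trivial_plan M R \<longleftrightarrow> wall_triple M R W1 W2"
proof -
  have W: "W1 = H \<and> W2 = V \<or> W1 = V \<and> W2 = H"
    using boundary_wall_at_corner[OF assms(1,4)] boundary_wall_at_corner[OF assms(2,5)] assms(3) by blast
  then have "boundary_wall (region M R) H" using assms(1,2) by blast
  moreover have "R B North \<le> y1" using module_bounds[OF B(1)] by simp
  ultimately have "\<not> trivial_plan M R \<longleftrightarrow> wall_triple M R H V"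
    using short_neighbour full_neighbour_no_triple full_neighbour_trivial by fastforce
  with W wall_triple_commute show ?thesis by blast
qed

end

section \<open>Reflections\<close>

lemma share_segment_image:
  assumes "linear f" "inj f"
  shows "share_segment (f ` S) (f ` T) \<longleftrightarrow> share_segment S T"
proof
  assume "share_segment (f ` S) (f ` T)"
  then obtain a b where ab: "a \<noteq> b" "closed_segment a b \<subseteq> f ` S \<inter> f ` T"
    unfolding share_segment_def by blast
  then have "a \<in> f ` S" "b \<in> f ` S" by (meson IntD1 ends_in_segment subsetD)+
  then obtain a' b' where e: "a = f a'" "b = f b'" by blast
  have "f ` closed_segment a' b' \<subseteq> f ` (S \<inter> T)"
    using ab(2) closed_segment_linear_image[OF assms(1), of a' b'] image_Int[OF assms(2)] by (simp add: e)
  then have "closed_segment a' b' \<subseteq> S \<inter> T" using inj_image_subset_iff[OF assms(2)] by blast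
  moreover have "a' \<noteq> b'" using ab(1) e by blast
  ultimately show "share_segment S T" unfolding share_segment_def by blast
next
  assume "share_segment S T"
  then obtain a b where ab: "a \<noteq> b" "closed_segment a b \<subseteq> S \<inter> T"
    unfolding share_segment_def by blast
  have "closed_segment (f a) (f b) \<subseteq> f ` S \<inter> f ` T"
    using ab(2) closed_segment_linear_image[OF assms(1), of a b] by auto
  moreover have "f a \<noteq> f b" using ab(1) assms(2) by (simp add: inj_eq)
  ultimately show "share_segment (f ` S) (f ` T)" unfolding share_segment_def by blast
qed

lemma frontier_injective_linear_image:
  fixes f :: "'a::euclidean_space \<Rightarrow> 'a"
  assumes "linear f" "inj f"
  shows "frontier (f ` S) = f ` frontier S"
  unfolding frontier_def
  by (simp add: closure_injective_linear_image[OF assms] interior_injective_linear_image[OF assms]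
      image_set_diff[OF assms(2)])

text \<open>An involution of the plane, given by its action \<open>f\<close> on points,
  \<open>T\<close> on rectangles and \<open>\<pi>\<close> on edges; \<open>sg\<close> is the sign a
  coordinate picks up. Signs agree on opposite edges, so one displacement of a wall becomes one
  displacement of its image. The condition \<open>shift\<close> says that axis-parallel crosses are
  mapped to such crosses.\<close>

locale plan_symmetry =
  fixes f :: "real \<times> real \<Rightarrow> real \<times> real" and T :: "rect \<Rightarrow> rect" and \<pi> :: "edge \<Rightarrow> edge"
    and sg :: "edge \<Rightarrow> real"
  assumes lin: "linear f" and ff: "f (f z) = z" and TT: "T (T r) = r" and pp: "\<pi> (\<pi> e) = e"
    and rect: "rect_set (T r) = f ` rect_set r"
    and side: "side (T r) (\<pi> e) = f ` side r e"
    and coord: "T r (\<pi> e) = sg e * r e"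
    and sg: "sg West = sg East" "sg South = sg North"
    and axes: "\<pi> ` {West, East} = {West, East} \<and> \<pi> ` {South, North} = {South, North} \<or>
      \<pi> ` {West, East} = {South, North} \<and> \<pi> ` {South, North} = {West, East}"
    and nondegenerate: "r West < r East \<and> r South < r North \<Longrightarrow> T r West < T r East \<and> T r South < T r North"
    and axis_parallel: "fst a = fst b \<or> snd a = snd b \<Longrightarrow> fst (f a) = fst (f b) \<or> snd (f a) = snd (f b)"
    and concave: "concave_corner P p \<Longrightarrow> concave_corner (f ` P) (f p)"
    and shift: "{f z + (t, 0), f z + (0, t)} \<subseteq> f ` {z + (t, 0), z + (- t, 0), z + (0, t), z + (0, - t)}"
begin

lemma inj: "inj f"
  by (metis ff injI)

lemma image_image_f: "f ` f ` S = S"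
  by (simp add: image_image ff)

lemma TTo: "T \<circ> (T \<circ> R) = R"
  by (auto simp: TT)

lemma region: "region M (T \<circ> R) = f ` region M R"
  by (simp add: region_def rect image_UN)

lemma frontier: "frontier (f ` S) = f ` frontier S"
  by (rule frontier_injective_linear_image[OF lin inj])

lemma share: "share_segment (side (T r) e) (f ` w) \<longleftrightarrow> share_segment (side r (\<pi> e)) w"
  using side[of r "\<pi> e"] by (simp add: pp share_segment_image[OF lin inj])

lemma share_side: "share_segment (side (T r) e) (side (T r') e') \<longleftrightarrow>
    share_segment (side r (\<pi> e)) (side r' (\<pi> e'))"
  using share[of r e "side r' (\<pi> e')"] side[of r' "\<pi> e'"] by (simp add: pp)

lemma floor_plan:
  assumes "floor_plan M R"
  shows "floor_plan M (T \<circ> R)"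
proof -
  obtain g where g: "simple_path g" "pathfinish g = pathstart g" "path_image g = frontier (region M R)"
    using assms unfolding floor_plan_iff by blast
  have "simple_path (f \<circ> g)" using g(1) by (simp add: simple_path_linear_image_eq[OF lin inj])
  moreover have "pathfinish (f \<circ> g) = pathstart (f \<circ> g)"
    using g(2) by (simp add: pathfinish_compose pathstart_compose)
  moreover have "path_image (f \<circ> g) = frontier (region M (T \<circ> R))"
    by (simp add: path_image_compose g(3) region frontier)
  moreover have "interior (rect_set (T r)) \<inter> interior (rect_set (T r')) = {} \<longleftrightarrow>
      interior (rect_set r) \<inter> interior (rect_set r') = {}" for r r'
    unfolding rect interior_injective_linear_image[OF lin inj] image_Int[OF inj, symmetric]
    by simp
  moreover have "(T \<circ> R) i West < (T \<circ> R) i East \<and> (T \<circ> R) i South < (T \<circ> R) i North" if "i \<in> M" for i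
    using assms that nondegenerate[of "R i"] unfolding floor_plan_def by simp
  moreover have "finite M" using assms by (simp add: floor_plan_def)
  moreover have "\<forall>i\<in>M. \<forall>j\<in>M. i \<noteq> j \<longrightarrow> interior (rect_set (R i)) \<inter> interior (rect_set (R j)) = {}"
    using assms by (simp add: floor_plan_def)
  ultimately show ?thesis
    unfolding floor_plan_def by (intro conjI ballI impI exI[of _ "f \<circ> g"]) simp_all
qed

lemma concave_iff: "concave_corner (f ` P) (f p) \<longleftrightarrow> concave_corner P p"
  using concave[of P p] concave[of "f ` P" "f p"] by (auto simp: image_image_f ff)

lemma num_concave_corners: "num_concave_corners M (T \<circ> R) = num_concave_corners M R"
proof -
  have "{p. concave_corner (region M (T \<circ> R)) p} = f ` {p. concave_corner (region M R) p}"
    unfolding region using concave_iff[of "region M R"] by (auto; metis ff image_eqI mem_Collect_eq)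
  then show ?thesis
    unfolding num_concave_corners_def by (simp add: card_image inj_on_subset[OF inj])
qed

lemma boundary_wall_image:
  assumes "boundary_wall P w"
  shows "boundary_wall (f ` P) (f ` w)"
proof -
  have fr: "w \<subseteq> frontier P"
    and mx: "\<And>a b. w \<subseteq> closed_segment a b \<Longrightarrow> closed_segment a b \<subseteq> frontier P \<Longrightarrow> closed_segment a b = w"
    using assms unfolding boundary_wall_def by metis+
  have "\<exists>a b. a \<noteq> b \<and> (fst a = fst b \<or> snd a = snd b) \<and> w = closed_segment a b"
    using assms unfolding boundary_wall_def by (rule conjunct1)
  then obtain a b where ab: "a \<noteq> b" "fst a = fst b \<or> snd a = snd b" "w = closed_segment a b"
    by (elim exE conjE)
  show ?thesis
    unfolding boundary_wall_def
  proof (intro conjI allI impI)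
    have "f a \<noteq> f b" using ab(1) inj by (simp add: inj_eq)
    moreover have "f ` w = closed_segment (f a) (f b)"
      unfolding ab(3) by (simp add: closed_segment_linear_image[OF lin])
    ultimately show "\<exists>a b. a \<noteq> b \<and> (fst a = fst b \<or> snd a = snd b) \<and> f ` w = closed_segment a b"
      using axis_parallel[OF ab(2)] by blast
    show "f ` w \<subseteq> frontier (f ` P)" using fr by (auto simp: frontier)
    fix c d assume cd: "f ` w \<subseteq> closed_segment c d \<and> closed_segment c d \<subseteq> frontier (f ` P)"
    have seg: "closed_segment c d = f ` closed_segment (f c) (f d)"
      by (simp add: closed_segment_linear_image[OF lin, symmetric] ff)
    have "w \<subseteq> closed_segment (f c) (f d)" "closed_segment (f c) (f d) \<subseteq> frontier P"
      using cd by (simp_all add: seg frontier inj_image_subset_iff[OF inj])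
    then show "closed_segment c d = f ` w" using mx seg by metis
  qed
qed

lemma adjacencies:
  "(\<forall>i j. (vertically_adjacent (T \<circ> R) i j \<longleftrightarrow> vertically_adjacent R i j) \<and>
      (horizontally_adjacent (T \<circ> R) i j \<longleftrightarrow> horizontally_adjacent R i j)) \<or>
   (\<forall>i j. (vertically_adjacent (T \<circ> R) i j \<longleftrightarrow> horizontally_adjacent R i j) \<and>
      (horizontally_adjacent (T \<circ> R) i j \<longleftrightarrow> vertically_adjacent R i j))"
proof -
  have sh: "(\<exists>e\<in>E. \<exists>e'\<in>E. share_segment (side (T r) e) (side (T r') e')) \<longleftrightarrow>
      (\<exists>e\<in>\<pi> ` E. \<exists>e'\<in>\<pi> ` E. share_segment (side r e) (side r' e'))" for E r r'
    by (auto simp: share_side)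
  from axes show ?thesis
  proof
    assume "\<pi> ` {West, East} = {West, East} \<and> \<pi> ` {South, North} = {South, North}"
    then show ?thesis
      unfolding vertically_adjacent_def horizontally_adjacent_def comp_def sh by simp
  next
    assume "\<pi> ` {West, East} = {South, North} \<and> \<pi> ` {South, North} = {West, East}"
    then show ?thesis
      unfolding vertically_adjacent_def horizontally_adjacent_def comp_def sh by simp
  qed
qed

lemma adjacent: "adjacent (T \<circ> R) i j \<longleftrightarrow> adjacent R i j"
  using adjacencies[of R] unfolding adjacent_def by blast

lemma stretch_image:
  assumes "stretch M R R'"
  shows "stretch M (T \<circ> R) (T \<circ> R')"
proof -
  obtain w \<delta> where w: "boundary_wall (region M R) w"
    and R': "\<And>i e. i \<in> M \<Longrightarrow> R' i e = (if share_segment (side (R i) e) w then R i e + \<delta> else R i e)"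
    and fp: "floor_plan M R'" and adj: "\<And>i j. i \<in> M \<Longrightarrow> j \<in> M \<Longrightarrow> adjacent R' i j \<longleftrightarrow> adjacent R i j"
    using assms unfolding stretch_def by blast
  \<comment> \<open>All sides on \<open>w\<close> are parallel, so they pick up the same sign
    \<open>c\<close>, and \<open>c * \<delta>\<close> is the displacement of the image wall.\<close>
  obtain c where c: "\<And>r e. share_segment (side r e) w \<Longrightarrow> sg e = c"
    using w
  proof (cases rule: boundary_wall_cases)
    case (vertical x a b)
    then have "sg e = sg West" if "share_segment (side r e) w" for r e
      using share_segment_side_vertical(1)[of r e x a b] that sg by auto
    then show thesis by (rule that)
  next
    case (horizontal y a b)
    then have "sg e = sg South" if "share_segment (side r e) w" for r e
      using share_segment_side_horizontal(1)[of r e a b y] that sg by auto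
    then show thesis by (rule that)
  qed
  have T: "T r e = sg (\<pi> e) * r (\<pi> e)" for r e
    using coord[of r "\<pi> e"] by (simp add: pp)
  have "(T \<circ> R') i e = (if share_segment (side ((T \<circ> R) i) e) (f ` w) then (T \<circ> R) i e + c * \<delta> else (T \<circ> R) i e)"
    if "i \<in> M" for i e
    using c[of "R i" "\<pi> e"] by (simp add: share T[of "R i"] T[of "R' i"] R'[OF that] algebra_simps)
  moreover have "boundary_wall (region M (T \<circ> R)) (f ` w)"
    unfolding region by (rule boundary_wall_image[OF w])
  ultimately have "\<exists>w \<delta>. boundary_wall (region M (T \<circ> R)) w \<and> (\<forall>i\<in>M. \<forall>e. (T \<circ> R') i e =
      (if share_segment (side ((T \<circ> R) i) e) w then (T \<circ> R) i e + \<delta> else (T \<circ> R) i e))"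
    by blast
  then show ?thesis
    unfolding stretch_def using floor_plan[OF fp] adj by (simp only: adjacent simp_thms) simp
qed

lemma stretches_image:
  assumes "(stretch M)\<^sup>*\<^sup>* R R'"
  shows "(stretch M)\<^sup>*\<^sup>* (T \<circ> R) (T \<circ> R')"
  using assms by induction (blast intro: rtranclp.rtrancl_into_rtrancl stretch_image)+

lemma trivial_plan_iff: "trivial_plan M (T \<circ> R) \<longleftrightarrow> trivial_plan M R"
proof -
  have "trivial_plan M (T \<circ> R)" if "trivial_plan M R" for R
    using that stretches_image num_concave_corners unfolding trivial_plan_def by metis
  from this[of R] this[of "T \<circ> R"] show ?thesis by (auto simp: TTo)
qed

lemma has_side_on_iff: "has_side_on (T \<circ> R) i (f ` S) \<longleftrightarrow> has_side_on R i S"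
  unfolding has_side_on_def comp_def share by (metis pp)

text \<open>A symmetry that exchanges the two kinds of adjacency merely swaps the two alternatives
  of the triple.\<close>

lemma wall_triple_iff: "wall_triple M (T \<circ> R) (f ` W1) (f ` W2) \<longleftrightarrow> wall_triple M R W1 W2"
proof -
  have "exterior_module M (T \<circ> R) i \<longleftrightarrow> exterior_module M R i" for i
    unfolding exterior_module_def region frontier has_side_on_iff ..
  with adjacencies[of R] show ?thesis
    unfolding wall_triple_def has_side_on_iff by (elim disjE) (simp; blast)+
qed

lemma four_joint_image:
  assumes "four_joint M R p"
  shows "four_joint M (T \<circ> R) (f p)"
proof -
  let ?S = "\<Union>i\<in>M. \<Union>e. side (R i) e"
  obtain d where d: "d > 0" "\<And>t. \<bar>t\<bar> < d \<Longrightarrow> p + (t, 0) \<in> ?S \<and> p + (0, t) \<in> ?S"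
    using assms unfolding four_joint_def by metis
  have S: "f ` ?S \<subseteq> (\<Union>i\<in>M. \<Union>e. side ((T \<circ> R) i) e)"
  proof
    fix z assume "z \<in> f ` ?S"
    then obtain i e where ie: "i \<in> M" "z \<in> f ` side (R i) e" by blast
    then have "z \<in> side ((T \<circ> R) i) (\<pi> e)" by (simp add: side)
    with ie(1) show "z \<in> (\<Union>i\<in>M. \<Union>e. side ((T \<circ> R) i) e)" by (intro UN_I) simp_all
  qed
  have "f p + (t, 0) \<in> f ` ?S \<and> f p + (0, t) \<in> f ` ?S" if "\<bar>t\<bar> < d" for t
  proof -
    have "{p + (t, 0), p + (- t, 0), p + (0, t), p + (0, - t)} \<subseteq> ?S"
      using d(2)[of t] d(2)[of "- t"] that by simp
    then have "{f p + (t, 0), f p + (0, t)} \<subseteq> f ` ?S"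
      using shift[of p t] by (meson image_mono order_trans)
    then show ?thesis by simp
  qed
  then show ?thesis
    unfolding four_joint_def using S d(1) by (intro exI[of _ d] conjI allI impI) (meson subsetD)+
qed

lemma four_joint_iff: "four_joint M (T \<circ> R) (f p) \<longleftrightarrow> four_joint M R p"
  using four_joint_image[of M R p] four_joint_image[of M "T \<circ> R" "f p"] by (auto simp: TTo ff)

text \<open>The claim for the transformed plan is a premise with arbitrary walls, so several
  symmetries can be chained by applying this rule repeatedly.\<close>

lemma nontrivial_iff_transfer:
  assumes "L_shaped_floor_plan M R" "boundary_wall (region M R) W1" "boundary_wall (region M R) W2"
    and "W1 \<noteq> W2" "p \<in> W1" "p \<in> W2" "\<not> four_joint M R p"
    and *: "\<And>W1 W2. L_shaped_floor_plan M (T \<circ> R) \<Longrightarrow> boundary_wall (region M (T \<circ> R)) W1 \<Longrightarrow>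
      boundary_wall (region M (T \<circ> R)) W2 \<Longrightarrow> W1 \<noteq> W2 \<Longrightarrow> f p \<in> W1 \<Longrightarrow> f p \<in> W2 \<Longrightarrow>
      \<not> four_joint M (T \<circ> R) (f p) \<Longrightarrow> \<not> trivial_plan M (T \<circ> R) \<longleftrightarrow> wall_triple M (T \<circ> R) W1 W2"
  shows "\<not> trivial_plan M R \<longleftrightarrow> wall_triple M R W1 W2"
proof -
  have "L_shaped_floor_plan M (T \<circ> R)"
    using assms(1) floor_plan[of M R] num_concave_corners[of M R] unfolding L_shaped_floor_plan_def by metis
  moreover have "f ` W1 \<noteq> f ` W2" using assms(4) inj by (simp add: inj_image_eq_iff)
  ultimately have "\<not> trivial_plan M (T \<circ> R) \<longleftrightarrow> wall_triple M (T \<circ> R) (f ` W1) (f ` W2)"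
    using assms(2-7) boundary_wall_image by (intro *) (auto simp: region four_joint_iff)
  then show ?thesis by (simp add: trivial_plan_iff wall_triple_iff)
qed

end

section \<open>Reflection in the vertical axis and exchange of the coordinates\<close>

fun reflect :: "rect \<Rightarrow> rect" where
  "reflect r West = - r East" | "reflect r East = - r West"
| "reflect r South = r South" | "reflect r North = r North"

fun transpose_rect :: "rect \<Rightarrow> rect" where
  "transpose_rect r West = r South" | "transpose_rect r East = r North"
| "transpose_rect r South = r West" | "transpose_rect r North = r East"

fun reflect_edge :: "edge \<Rightarrow> edge" where
  "reflect_edge West = East" | "reflect_edge East = West"
| "reflect_edge South = South" | "reflect_edge North = North"

fun transpose_edge :: "edge \<Rightarrow> edge" where
  "transpose_edge West = South" | "transpose_edge East = North"
| "transpose_edge South = West" | "transpose_edge North = East"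

lemma concave_towards_reflect:
  assumes "concave_towards sx sy P p"
  shows "concave_towards (- sx) sy ((\<lambda>(x, y). (- x, y)) ` P) (- fst p, snd p)"
proof -
  obtain e where e: "e > 0" "\<And>u v. \<bar>u\<bar> < e \<Longrightarrow> \<bar>v\<bar> < e \<Longrightarrow> p + (u, v) \<in> P \<longleftrightarrow> \<not> (sx * u > 0 \<and> sy * v > 0)"
    using assms unfolding concave_towards_def by blast
  have "(- fst p, snd p) + (u, v) \<in> (\<lambda>(x, y). (- x, y)) ` P \<longleftrightarrow> p + (- u, v) \<in> P" for u v
  proof -
    have "(- fst p, snd p) + (u, v) = (\<lambda>(x, y). (- x, y)) (p + (- u, v))" by (cases p) simp
    moreover have "inj (\<lambda>(x, y). (- x, y) :: real \<times> real)" by (auto simp: inj_on_def)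
    ultimately show ?thesis by (metis inj_image_mem_iff)
  qed
  then show ?thesis
    unfolding concave_towards_def using e by (intro exI[of _ e]) auto
qed

lemma concave_towards_transpose:
  assumes "concave_towards sx sy P p"
  shows "concave_towards sy sx (prod.swap ` P) (prod.swap p)"
proof -
  obtain e where e: "e > 0" "\<And>u v. \<bar>u\<bar> < e \<Longrightarrow> \<bar>v\<bar> < e \<Longrightarrow> p + (u, v) \<in> P \<longleftrightarrow> \<not> (sx * u > 0 \<and> sy * v > 0)"
    using assms unfolding concave_towards_def by blast
  have "prod.swap p + (u, v) \<in> prod.swap ` P \<longleftrightarrow> p + (v, u) \<in> P" for u v
  proof -
    have "prod.swap p + (u, v) = prod.swap (p + (v, u))" by (cases p) simp
    then show ?thesis by (metis inj_image_mem_iff inj_swap)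
  qed
  then show ?thesis
    unfolding concave_towards_def using e by (intro exI[of _ e]) auto
qed

lemma reflect_image: "(\<lambda>(x, y). (- x, y)) ` (A \<times> B) = uminus ` A \<times> B"
  by force

interpretation reflection: plan_symmetry "\<lambda>(x, y). (- x, y)" reflect reflect_edge
  "\<lambda>e. if e \<in> {West, East} then - 1 else 1"
proof -
  have side: "side (reflect r) (reflect_edge e) = (\<lambda>(x, y). (- x, y)) ` side r e" for r e
    by (cases e) (simp_all add: reflect_image)
  have pp: "reflect_edge (reflect_edge e) = e" for e by (cases e) auto
  show "plan_symmetry (\<lambda>(x, y). (- x, y)) reflect reflect_edge (\<lambda>e. if e \<in> {West, East} then - 1 else 1)"
  proof (rule plan_symmetry.intro)
    show "linear (\<lambda>(x, y). (- x, y) :: real \<times> real)" by (intro linearI) auto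
    show "reflect (reflect r) = r" for r
    proof
      show "reflect (reflect r) e = r e" for e by (cases e) auto
    qed
    show "reflect r (reflect_edge e) = (if e \<in> {West, East} then - 1 else 1) * r e" for r e
      by (cases e) auto
    show "concave_corner ((\<lambda>(x, y). (- x, y)) ` P) (case p of (x, y) \<Rightarrow> (- x, y))"
      if "concave_corner P p" for P p
      using that concave_towards_reflect[of _ _ P p] unfolding concave_corner_iff
      by (cases p) fastforce
  qed (auto simp: side pp rect_set_def reflect_image)
qed

interpretation transposition: plan_symmetry prod.swap transpose_rect transpose_edge "\<lambda>e. 1"
proof -
  have side: "side (transpose_rect r) (transpose_edge e) = prod.swap ` side r e" for r e
    by (cases e) (simp_all add: product_swap)
  have pp: "transpose_edge (transpose_edge e) = e" for e by (cases e) auto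
  show "plan_symmetry prod.swap transpose_rect transpose_edge (\<lambda>e. 1)"
  proof (rule plan_symmetry.intro)
    show "linear (prod.swap :: real \<times> real \<Rightarrow> _)" by (intro linearI) auto
    show "transpose_rect (transpose_rect r) = r" for r
    proof
      show "transpose_rect (transpose_rect r) e = r e" for e by (cases e) auto
    qed
    show "transpose_rect r (transpose_edge e) = 1 * r e" for r e
      by (cases e) auto
    show "concave_corner (prod.swap ` P) (prod.swap p)" if "concave_corner P p" for P p
      using that concave_towards_transpose[of _ _ P p] unfolding concave_corner_iff by blast
  qed (auto simp: side pp rect_set_def product_swap)
qed

section \<open>Reduction to normal position\<close>

lemma nontrivial_iff_straddling_module:
  assumes L: "L_shaped_floor_plan M R" and c: "concave_towards 1 1 (region M R) (px, py)"
    and W: "boundary_wall (region M R) W1" "boundary_wall (region M R) W2" "W1 \<noteq> W2"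
      "(px, py) \<in> W1" "(px, py) \<in> W2"
    and B: "B \<in> M" "R B East = px" "R B South < py" "py < R B North"
  shows "\<not> trivial_plan M R \<longleftrightarrow> wall_triple M R W1 W2"
proof -
  have fp: "floor_plan M R" and n: "num_concave_corners M R = 1"
    using L by (auto simp: L_shaped_floor_plan_def)
  then have V: "valid_plan M R" by (simp add: floor_plan_iff)
  have "concave_corner (region M R) (px, py)" using c concave_corner_iff by blast
  then have "q = (px, py)" if "concave_corner (region M R) q" for q
    using n that unfolding num_concave_corners_def by (metis card_1_singletonE mem_Collect_eq singletonD)
  then obtain x0 x1 y0 y1 where "x0 < px" "px < x1" "y0 < py" "py < y1"
    "region M R = L_region x0 px x1 y0 py y1"
    using unique_concave_corner_L_region[OF fp c] by metis
  then interpret notched_plan M R B x0 px x1 y0 py y1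
    using fp n B concave_ne_filled[OF V c] by unfold_locales
  show ?thesis by (rule nontrivial_iff_wall_triple[OF W])
qed

text \<open>Everything depends on the module \<open>X\<close> in the south-west quadrant. It cannot
  enter the notch, so it passes the corner northwards, eastwards, or not at all. In the first case
  it is the straddling module, in the second it becomes one after transposition, and the third is a
  four-joint.\<close>

lemma nontrivial_iff_ne:
  assumes L: "L_shaped_floor_plan M R" and c: "concave_towards 1 1 (region M R) (px, py)"
    and W: "boundary_wall (region M R) W1" "boundary_wall (region M R) W2" "W1 \<noteq> W2"
      "(px, py) \<in> W1" "(px, py) \<in> W2"
    and nj: "\<not> four_joint M R (px, py)"
  shows "\<not> trivial_plan M R \<longleftrightarrow> wall_triple M R W1 W2"
proof -
  have V: "valid_plan M R"
    using L by (simp add: L_shaped_floor_plan_def floor_plan_iff)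
  note pos = valid_planD(2,3)[OF V] and f = concave_ne_filled[OF V c]
  obtain X where X: "X \<in> M" "R X West < px" "px \<le> R X East" "R X South < py" "py \<le> R X North"
    using f(4) unfolding filled_sw_def by blast
  obtain Y where Y: "Y \<in> M" "R Y West < px" "px \<le> R Y East" "R Y South \<le> py" "py < R Y North"
    using f(2) unfolding filled_nw_def by blast
  obtain Z where Z: "Z \<in> M" "R Z West \<le> px" "px < R Z East" "R Z South < py" "py \<le> R Z North"
    using f(3) unfolding filled_se_def by blast
  have ne: "\<not> (R i West \<le> px \<and> px < R i East \<and> R i South \<le> py \<and> py < R i North)" if "i \<in> M" for i
    using f(1) that unfolding filled_ne_def by blast
  have YE: "R Y East = px" and ZN: "R Z North = py"
    using ne[OF Y(1)] ne[OF Z(1)] Y Z by auto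
  consider "R X East = px" "py < R X North" | "R X North = py" "px < R X East"
    | "R X East = px" "R X North = py"
    using ne[OF X(1)] X by force
  then show ?thesis
  proof cases
    case 1
    then show ?thesis using nontrivial_iff_straddling_module[OF L c W X(1)] X by blast
  next
    case 2
    show ?thesis
    proof (rule transposition.nontrivial_iff_transfer[OF L W nj])
      fix W1 W2
      assume a: "L_shaped_floor_plan M (transpose_rect \<circ> R)"
        "boundary_wall (region M (transpose_rect \<circ> R)) W1"
        "boundary_wall (region M (transpose_rect \<circ> R)) W2" "W1 \<noteq> W2"
        "prod.swap (px, py) \<in> W1" "prod.swap (px, py) \<in> W2"
      have "concave_towards 1 1 (region M (transpose_rect \<circ> R)) (py, px)"
        using concave_towards_transpose[OF c] by (simp add: transposition.region)
      then show "\<not> trivial_plan M (transpose_rect \<circ> R) \<longleftrightarrow> wall_triple M (transpose_rect \<circ> R) W1 W2"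
        by (rule nontrivial_iff_straddling_module[OF a(1) _ a(2-4)]) (use a X 2 in auto)
    qed
  next
    case 3
    have "X \<noteq> Y" "X \<noteq> Z" using 3 Y Z by auto
    have YS: "R Y South = py"
      using valid_planD(4)[OF V X(1) Y(1) \<open>X \<noteq> Y\<close>] X Y 3 YE by auto
    have ZW: "R Z West = px"
      using valid_planD(4)[OF V X(1) Z(1) \<open>X \<noteq> Z\<close>] X Z 3 ZN by auto
    \<comment> \<open>The shortest of the four arms: west and south along \<open>X\<close>, east
      along \<open>Z\<close>, north along \<open>Y\<close>.\<close>
    define e where "e = min (min (px - R X West) (R Z East - px)) (min (R Y North - py) (py - R X South))"
    have e: "e > 0" "e \<le> px - R X West" "e \<le> R Z East - px" "e \<le> R Y North - py" "e \<le> py - R X South"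
      using X Y Z by (auto simp: e_def)
    have "(px, py) + (t, 0) \<in> (\<Union>i\<in>M. \<Union>e. side (R i) e) \<and>
        (px, py) + (0, t) \<in> (\<Union>i\<in>M. \<Union>e. side (R i) e)" if "\<bar>t\<bar> < e" for t
    proof (cases "t \<ge> 0")
      case True
      have "(px, py) + (t, 0) \<in> side (R Z) North" "(px, py) + (0, t) \<in> side (R Y) East"
        using True that e ZN ZW YE YS by auto
      then show ?thesis using Y(1) Z(1) by blast
    next
      case False
      have "(px, py) + (t, 0) \<in> side (R X) North" "(px, py) + (0, t) \<in> side (R X) East"
        using False that e 3 by auto
      then show ?thesis using X(1) by blast
    qed
    then have "four_joint M R (px, py)" unfolding four_joint_def using e(1) by blast
    with nj show ?thesis by blast
  qed
qed

lemma nontrivial_iff_north: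
  assumes L: "L_shaped_floor_plan M R" and c: "concave_towards sx 1 (region M R) p" "sx \<in> {-1, 1}"
    and W: "boundary_wall (region M R) W1" "boundary_wall (region M R) W2" "W1 \<noteq> W2" "p \<in> W1" "p \<in> W2"
    and nj: "\<not> four_joint M R p"
  shows "\<not> trivial_plan M R \<longleftrightarrow> wall_triple M R W1 W2"
proof (cases "sx = 1")
  case True
  then show ?thesis
    using nontrivial_iff_ne[OF L, of "fst p" "snd p"] assms by simp
next
  case False
  with c have c: "concave_towards (-1) 1 (region M R) p" by simp
  show ?thesis
  proof (rule reflection.nontrivial_iff_transfer[OF L W nj])
    fix W1 W2
    assume a: "L_shaped_floor_plan M (reflect \<circ> R)"
      "boundary_wall (region M (reflect \<circ> R)) W1"
      "boundary_wall (region M (reflect \<circ> R)) W2" "W1 \<noteq> W2"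
      "(case p of (x, y) \<Rightarrow> (- x, y)) \<in> W1" "(case p of (x, y) \<Rightarrow> (- x, y)) \<in> W2"
      "\<not> four_joint M (reflect \<circ> R) (case p of (x, y) \<Rightarrow> (- x, y))"
    have "concave_towards 1 1 (region M (reflect \<circ> R)) (- fst p, snd p)"
      using concave_towards_reflect[OF c] by (simp add: reflection.region)
    then show "\<not> trivial_plan M (reflect \<circ> R) \<longleftrightarrow> wall_triple M (reflect \<circ> R) W1 W2"
      by (rule nontrivial_iff_ne[OF a(1) _ a(2-4)]) (use a in \<open>auto split: prod.splits\<close>)
  qed
qed

theorem theorem2:
  fixes M :: "'m set" and R :: "'m \<Rightarrow> rect"
    and W1 W2 :: "(real \<times> real) set" and p :: "real \<times> real"
  assumes "L_shaped_floor_plan M R"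
    and "concave_corner (region M R) p"
    and "boundary_wall (region M R) W1" and "boundary_wall (region M R) W2"
    and "W1 \<noteq> W2" and "p \<in> W1" and "p \<in> W2"
    and "\<not> four_joint M R p"
  shows "\<not> trivial_plan M R \<longleftrightarrow>
    (\<exists>A B C. distinct [A, B, C] \<and>
       (\<forall>X\<in>{A, B, C}. exterior_module M R X \<and> (has_side_on R X W1 \<or> has_side_on R X W2)) \<and>
       ((vertically_adjacent R A B \<and> horizontally_adjacent R B C) \<or>
        (horizontally_adjacent R A B \<and> vertically_adjacent R B C)))"
proof -
  obtain sx sy where s: "sx \<in> {-1, 1}" "sy \<in> {-1, 1}" and c: "concave_towards sx sy (region M R) p"
    using assms(2) unfolding concave_corner_iff by blast
  have "\<not> trivial_plan M R \<longleftrightarrow> wall_triple M R W1 W2"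
  proof (cases "sy = 1")
    case True
    then show ?thesis using nontrivial_iff_north[OF assms(1) _ s(1) assms(3-8)] c by simp
  next
    case False
    with s c have c: "concave_towards sx (-1) (region M R) p" by simp
    \<comment> \<open>Transposing, reflecting and transposing again amounts to the reflection in the
      horizontal axis, which turns the second sign from -1 into 1.\<close>
    show ?thesis
    proof (rule transposition.nontrivial_iff_transfer[OF assms(1,3-8)])
      fix W1 W2
      assume a: "L_shaped_floor_plan M (transpose_rect \<circ> R)"
        "boundary_wall (region M (transpose_rect \<circ> R)) W1"
        "boundary_wall (region M (transpose_rect \<circ> R)) W2" "W1 \<noteq> W2"
        "prod.swap p \<in> W1" "prod.swap p \<in> W2" "\<not> four_joint M (transpose_rect \<circ> R) (prod.swap p)"
      have c': "concave_towards (-1) sx (region M (transpose_rect \<circ> R)) (prod.swap p)"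
        using concave_towards_transpose[OF c] by (simp add: transposition.region)
      show "\<not> trivial_plan M (transpose_rect \<circ> R) \<longleftrightarrow> wall_triple M (transpose_rect \<circ> R) W1 W2"
      proof (rule reflection.nontrivial_iff_transfer[OF a])
        fix W1 W2
        let ?R = "reflect \<circ> (transpose_rect \<circ> R)" and ?p = "case prod.swap p of (x, y) \<Rightarrow> (- x, y)"
        assume b: "L_shaped_floor_plan M ?R" "boundary_wall (region M ?R) W1"
          "boundary_wall (region M ?R) W2" "W1 \<noteq> W2" "?p \<in> W1" "?p \<in> W2" "\<not> four_joint M ?R ?p"
        have d: "concave_towards 1 sx (region M ?R) ?p"
          using concave_towards_reflect[OF c'] by (simp add: reflection.region case_prod_beta)
        show "\<not> trivial_plan M ?R \<longleftrightarrow> wall_triple M ?R W1 W2"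
        proof (rule transposition.nontrivial_iff_transfer[OF b])
          fix W1 W2
          assume e: "L_shaped_floor_plan M (transpose_rect \<circ> ?R)"
            "boundary_wall (region M (transpose_rect \<circ> ?R)) W1"
            "boundary_wall (region M (transpose_rect \<circ> ?R)) W2" "W1 \<noteq> W2"
            "prod.swap ?p \<in> W1" "prod.swap ?p \<in> W2" "\<not> four_joint M (transpose_rect \<circ> ?R) (prod.swap ?p)"
          have "concave_towards sx 1 (region M (transpose_rect \<circ> ?R)) (prod.swap ?p)"
            using concave_towards_transpose[OF d] by (simp add: transposition.region)
          then show "\<not> trivial_plan M (transpose_rect \<circ> ?R) \<longleftrightarrow> wall_triple M (transpose_rect \<circ> ?R) W1 W2"
            using s(1) by (rule nontrivial_iff_north[OF e(1) _ _ e(2-7)])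
        qed
      qed
    qed
  qed
  then show ?thesis unfolding wall_triple_def .
qed

end
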